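(* Let $R$ be a relation on $X\times Y$. Suppose $(\sigma,\gamma)\in P_R$, with $\sigma\neq X$. Let $Q$ be the relation modeling $\mathrm{Lk}(\Psi_R,\sigma)$. Then the following three conditions are equivalent: (a) $(\phi_R\circ\psi_R)(\gamma')=\gamma'$ for every subset $\gamma'$ of $\gamma$. (b) $\mathrm{Lk}(\Psi_R,\sigma)\simeq\mathbb{S}^{k-2}$, with $k=|\gamma|$. (c) $\Phi_Q=\partial(\gamma)$.
   Context: Everything is finite. A relation $R$ on $X\times Y$ is a subset of $X\times Y$. For $x\in X$, $Y_x=\{y\in Y:(x,y)\in R\}$; for $y\in Y$, $X_y=\{x\in X:(x,y)\in R\}$. For $\sigma\subseteq X$, $\phi_R(\sigma)=\bigcap_{x\in\sigma}Y_x$ with $\phi_R(\emptyset)=Y$; for $\gamma\subseteq Y$, $\psi_R(\gamma)=\bigcap_{y\in\gamma}X_y$ with $\psi_R(\emptyset)=X$. When $X,Y$ are nonempty, the Dowker complexes are $\Phi_R=\{\gamma\subseteq Y:\exists x\in X\ \forall y\in\gamma\ (x,y)\in R\}$ and $\Psi_R=\{\sigma\subseteq X:\exists y\in Y\ \forall x\in\sigma\ (x,y)\in R\}$; both contain $\emptyset$ as a simplex. The doubly-labeled poset $P_R$ consists of all pairs $(\sigma,\gamma)$ with $\emptyset\ne\sigma\in\Psi_R$, $\emptyset\neq\gamma\in\Phi_R$, $\sigma=\psi_R(\gamma)$ and $\gamma=\phi_R(\sigma)$, ordered by $(\sigma_1,\gamma_1)\le(\sigma_2,\gamma_2)$ iff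 $\sigma_1\subseteq\sigma_2$ (equivalently $\gamma_1\supseteq\gamma_2$). For a simplicial complex $\Sigma$ and set $\sigma$, $\mathrm{Lk}(\Sigma,\sigma)=\{\tau\in\Sigma:\tau\cap\sigma=\emptyset,\ \tau\cup\sigma\in\Sigma\}$. The relation $Q$ modeling $\mathrm{Lk}(\Psi_R,\sigma)$ is the restriction of $R$ to $\overline X\times\gamma$, that is, $Q=R\cap(\overline X\times\gamma)$, where $\gamma=\phi_R(\sigma)$ and $\overline X=\bigcup_{y\in\gamma}(X_y\setminus\sigma)$; its Dowker complexes, when $\overline X$ and $\gamma$ are nonempty, are $\Phi_Q=\{\eta\subseteq\gamma:\exists z\in\overline X\ \forall y\in\eta\ (z,y)\in Q\}$ and $\Psi_Q=\{\tau\subseteq\overline X:\exists y\in\gamma\ \forall z\in\tau\ (z,y)\in Q\}$, except that if $\overline X=\emptyset$ and $\gamma\neq\emptyset$ then $\Phi_Q=\Psi_Q=\{\emptyset\}$. For a nonempty finite set $V$, $\partial(V)$ is the simplicial complex of all proper subsets of $V$. $\simeq$ denotes homotopy equivalence. $\mathbb{S}^{-1}$ is the empty complex $\{\emptyset\}$; a complex is $\simeq\mathbb{S}^{-1}$ iff it equals $\{\emptyset\}$. The void complex (no simplices) is distinct from $\{\emptyset\}$ and not homotopy equivalent to any sphere. *)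

theory Defs
  imports "HOL-Analysis.Analysis"
begin

definition row :: "'b set \<Rightarrow> ('a \<times> 'b) set \<Rightarrow> 'a \<Rightarrow> 'b set" where
  "row Y R x = {y \<in> Y. (x, y) \<in> R}"

definition col :: "'a set \<Rightarrow> ('a \<times> 'b) set \<Rightarrow> 'b \<Rightarrow> 'a set" where
  "col X R y = {x \<in> X. (x, y) \<in> R}"

definition phi :: "'b set \<Rightarrow> ('a \<times> 'b) set \<Rightarrow> 'a set \<Rightarrow> 'b set" where
  "phi Y R \<sigma> = (if \<sigma> = {} then Y else (\<Inter>x\<in>\<sigma>. row Y R x))"

definition psi :: "'a set \<Rightarrow> ('a \<times> 'b) set \<Rightarrow> 'b set \<Rightarrow> 'a set" where
  "psi X R \<gamma> = (if \<gamma> = {} then X else (\<Inter>y\<in>\<gamma>. col X R y))"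

definition dowker_Phi :: "'a set \<Rightarrow> 'b set \<Rightarrow> ('a \<times> 'b) set \<Rightarrow> 'b set set" where
  "dowker_Phi X Y R = {\<gamma>. \<gamma> \<subseteq> Y \<and> (\<exists>x\<in>X. \<forall>y\<in>\<gamma>. (x, y) \<in> R)}"

definition dowker_Psi :: "'a set \<Rightarrow> 'b set \<Rightarrow> ('a \<times> 'b) set \<Rightarrow> 'a set set" where
  "dowker_Psi X Y R = {\<sigma>. \<sigma> \<subseteq> X \<and> (\<exists>y\<in>Y. \<forall>x\<in>\<sigma>. (x, y) \<in> R)}"

text \<open>The underlying set of the doubly-labeled poset; its order is
  \<open>(\<sigma>\<^sub>1, \<gamma>\<^sub>1) \<le> (\<sigma>\<^sub>2, \<gamma>\<^sub>2) \<longleftrightarrow> \<sigma>\<^sub>1 \<subseteq> \<sigma>\<^sub>2\<close>.\<close>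

definition doubly_labeled :: "'a set \<Rightarrow> 'b set \<Rightarrow> ('a \<times> 'b) set \<Rightarrow> ('a set \<times> 'b set) set" where
  "doubly_labeled X Y R =
     {(\<sigma>, \<gamma>). \<sigma> \<noteq> {} \<and> \<sigma> \<in> dowker_Psi X Y R \<and> \<gamma> \<noteq> {} \<and> \<gamma> \<in> dowker_Phi X Y R \<and>
        \<sigma> = psi X R \<gamma> \<and> \<gamma> = phi Y R \<sigma>}"

definition simplicial_link :: "'a set set \<Rightarrow> 'a set \<Rightarrow> 'a set set" where
  "simplicial_link \<Sigma> \<sigma> = {\<tau> \<in> \<Sigma>. \<tau> \<inter> \<sigma> = {} \<and> \<tau> \<union> \<sigma> \<in> \<Sigma>}"

definition boundary_complex :: "'a set \<Rightarrow> 'a set set" where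
  "boundary_complex V = {\<tau>. \<tau> \<subset> V}"

text \<open>The relation \<open>Q\<close> modeling the link of \<open>\<sigma>\<close> in \<open>dowker_Psi X Y R\<close>: it is a relation on
  \<open>link_rows X Y R \<sigma> \<times> phi Y R \<sigma>\<close>.\<close>

definition link_rows :: "'a set \<Rightarrow> 'b set \<Rightarrow> ('a \<times> 'b) set \<Rightarrow> 'a set \<Rightarrow> 'a set" where
  "link_rows X Y R \<sigma> = (\<Union>y\<in>phi Y R \<sigma>. col X R y - \<sigma>)"

definition link_rel :: "'a set \<Rightarrow> 'b set \<Rightarrow> ('a \<times> 'b) set \<Rightarrow> 'a set \<Rightarrow> ('a \<times> 'b) set" where
  "link_rel X Y R \<sigma> = R \<inter> (link_rows X Y R \<sigma> \<times> phi Y R \<sigma>)"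

text \<open>The complex \<open>\<Phi>\<^sub>Q\<close>. Without the case distinction \<open>dowker_Phi\<close> would be the void complex
  when \<open>link_rows X Y R \<sigma>\<close> is empty; by convention it is then the empty complex
  (for \<open>phi Y R \<sigma> \<noteq> {}\<close>, which holds for elements of the doubly-labeled poset).\<close>

definition link_Phi :: "'a set \<Rightarrow> 'b set \<Rightarrow> ('a \<times> 'b) set \<Rightarrow> 'a set \<Rightarrow> 'b set set" where
  "link_Phi X Y R \<sigma> =
     (if link_rows X Y R \<sigma> = {} \<and> phi Y R \<sigma> \<noteq> {} then {{}}
      else dowker_Phi (link_rows X Y R \<sigma>) (phi Y R \<sigma>) (link_rel X Y R \<sigma>))"

text \<open>Geometric realization, via barycentric coordinates, of a simplicial complex with finitely
  many vertices (for which all usual topologies on the realization coincide). The realizations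
  of \<open>{}\<close> and \<open>{{}}\<close> are both the empty space.\<close>

definition geometric_realization :: "'a set set \<Rightarrow> ('a \<Rightarrow> real) topology" where
  "geometric_realization \<Sigma> =
     subtopology (powertop_real (\<Union>\<Sigma>))
       {t. (\<forall>v\<in>\<Union>\<Sigma>. 0 \<le> t v) \<and> (\<Sum>v\<in>\<Union>\<Sigma>. t v) = 1 \<and> {v \<in> \<Union>\<Sigma>. t v \<noteq> 0} \<in> \<Sigma>}"

text \<open>Homotopy equivalence of a complex with the sphere of dimension \<open>n \<ge> -1\<close>. The sphere of
  dimension \<open>-1\<close> is the empty complex \<open>{{}}\<close>, which must be told apart from the void complex
  \<open>{}\<close> although both have empty realization.\<close>

definition homotopy_sphere :: "'a set set \<Rightarrow> int \<Rightarrow> bool" where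
  "homotopy_sphere \<Sigma> n \<longleftrightarrow>
     n = -1 \<and> \<Sigma> = {{}} \<or>
     n \<ge> 0 \<and> geometric_realization \<Sigma> homotopy_equivalent_space nsphere (nat n)"

end

theory Submission
  imports Defs "HOL-Homology.Homology"
begin

text \<open>The link of \<open>\<sigma>\<close> is \<open>\<Psi>\<^sub>Q\<close>, which by Dowker duality is homotopy equivalent to \<open>\<Phi>\<^sub>Q\<close>. No
  \<open>x \<notin> \<sigma>\<close> is related to all of \<open>\<gamma> = \<phi>(\<sigma>)\<close>, so \<open>\<Phi>\<^sub>Q\<close> is a subcomplex of \<open>\<partial>(\<gamma>)\<close>, a sphere
  of dimension \<open>n = k - 2\<close>. A proper subcomplex misses a facet and hence arises from a contractible
  complex by removing maximal faces of dimension at most \<open>n\<close> one at a time. Removing such a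
  face does not create reduced homology in degree \<open>n\<close>, because the relative homology of the pair is
  that of a closed ball of dimension at most \<open>n\<close> modulo its boundary and so vanishes in
  degree \<open>n + 1\<close>. Therefore a proper subcomplex has trivial reduced homology in degree \<open>n\<close> and
  is not homotopy equivalent to the sphere. The equivalence with (a) is elementary:
  \<open>\<gamma> - {y}\<close> is closed iff some \<open>x \<notin> \<sigma>\<close> is related to all of \<open>\<gamma>\<close> except \<open>y\<close>.\<close>

subsection \<open>Geometric realizations\<close>

abbreviation supp :: "('a \<Rightarrow> real) \<Rightarrow> 'a set" where
  "supp t \<equiv> {v. t v \<noteq> 0}"

text \<open>Points are functions on the whole vertex type, so all complexes share one ambient space
  and a subcomplex is realized as a subset. Infinite supports drop out, since their
  \<open>sum\<close> is 0 by convention.\<close>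

definition realization :: "'a set set \<Rightarrow> ('a \<Rightarrow> real) set" where
  "realization \<Sigma> = {t. (\<forall>v. 0 \<le> t v) \<and> supp t \<in> \<Sigma> \<and> sum t (supp t) = 1}"

definition down_closed :: "'a set set \<Rightarrow> bool" where
  "down_closed \<Sigma> \<longleftrightarrow> (\<forall>\<tau>\<in>\<Sigma>. \<forall>\<rho>\<subseteq>\<tau>. \<rho> \<in> \<Sigma>)"

lemma down_closedD: "down_closed \<Sigma> \<Longrightarrow> \<tau> \<in> \<Sigma> \<Longrightarrow> \<rho> \<subseteq> \<tau> \<Longrightarrow> \<rho> \<in> \<Sigma>"
  by (auto simp: down_closed_def)

lemma sum_supp: "finite V \<Longrightarrow> supp t \<subseteq> V \<Longrightarrow> sum t (supp t) = sum t V"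
  by (rule sum.mono_neutral_left) auto

lemma realizationI:
  assumes "finite V" "\<And>v. 0 \<le> t v" "supp t \<in> \<Sigma>" "supp t \<subseteq> V" "sum t V = 1"
  shows "t \<in> realization \<Sigma>"
  using assms by (simp add: realization_def sum_supp)

lemma realizationD:
  assumes "t \<in> realization \<Sigma>"
  shows "0 \<le> t v" "supp t \<in> \<Sigma>" "finite V \<Longrightarrow> supp t \<subseteq> V \<Longrightarrow> sum t V = 1"
  using assms sum_supp[of V t] by (auto simp: realization_def)

text \<open>The combination is supported in \<open>supp t \<union> supp u\<close>. Once that union
  is a face, down-closure handles the actual support, and the total mass stays 1.\<close>

lemma segment_in_realization:
  assumes "s \<in> {0..1}" "t \<in> realization \<Sigma>" "u \<in> realization \<Sigma>"
    and "down_closed \<Sigma>" "supp t \<union> supp u \<in> \<Sigma>" "finite (supp t \<union> supp u)"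
  shows "(\<lambda>v. (1 - s) * t v + s * u v) \<in> realization \<Sigma>"
proof -
  let ?w = "\<lambda>v. (1 - s) * t v + s * u v" and ?V = "supp t \<union> supp u"
  have sub: "supp ?w \<subseteq> ?V"
    by auto
  show ?thesis
  proof (rule realizationI[OF assms(6)])
    show "0 \<le> ?w v" for v
      using assms(1) realizationD(1)[OF assms(2)] realizationD(1)[OF assms(3)] by simp
    show "supp ?w \<in> \<Sigma>"
      using down_closedD[OF assms(4,5) sub] .
    have "sum t ?V = 1" "sum u ?V = 1"
      using realizationD(3)[OF assms(2) assms(6)] realizationD(3)[OF assms(3) assms(6)] by auto
    then show "sum ?w ?V = 1"
      by (simp add: sum.distrib flip: sum_distrib_left)
  qed (rule sub)
qed

text \<open>Functions carry the product topology, so continuity of the homotopy is checked one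
  coordinate at a time. The nontrivial homotopies below then reduce to showing that segments stay
  inside the target.\<close>

lemma homotopic_straight_line:
  fixes f g :: "'x::topological_space \<Rightarrow> 'a \<Rightarrow> real"
  assumes "continuous_on S f" "continuous_on S g"
    and "\<And>s x. s \<in> {0..1} \<Longrightarrow> x \<in> S \<Longrightarrow> (\<lambda>v. (1 - s) * f x v + s * g x v) \<in> T"
  shows "homotopic_with_canon (\<lambda>_. True) S T f g"
proof -
  let ?h = "\<lambda>p v. (1 - fst p) * f (snd p) v + fst p * g (snd p) v"
  have f: "continuous_on ({0..1::real} \<times> S) (\<lambda>p. f (snd p) v)" for v
    by (rule continuous_on_product_then_coordinatewise,
        rule continuous_on_compose2[OF assms(1) continuous_on_snd[OF continuous_on_id]]) auto
  have g: "continuous_on ({0..1::real} \<times> S) (\<lambda>p. g (snd p) v)" for v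
    by (rule continuous_on_product_then_coordinatewise,
        rule continuous_on_compose2[OF assms(2) continuous_on_snd[OF continuous_on_id]]) auto
  have "continuous_on ({0..1} \<times> S) ?h"
    by (intro continuous_on_coordinatewise_then_product continuous_intros f g)
  then show ?thesis
    unfolding homotopic_with_def
    by (intro exI[of _ ?h]) (use assms(3) in auto)
qed

text \<open>Extension by zero off the vertex set and restriction to it are continuous and mutually
  inverse.\<close>

lemma geometric_realization_homeomorphic:
  assumes "finite (\<Union>\<Sigma>)"
  shows "geometric_realization \<Sigma> homeomorphic_space top_of_set (realization \<Sigma>)"
proof -
  let ?V = "\<Union>\<Sigma>"
  let ?f = "\<lambda>(t :: 'a \<Rightarrow> real) v. if v \<in> ?V then t v else 0"
    and ?g = "\<lambda>t :: 'a \<Rightarrow> real. restrict t ?V"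
  have f_in: "?f t \<in> realization \<Sigma>" if "t \<in> topspace (geometric_realization \<Sigma>)" for t
  proof (rule realizationI[OF assms])
    have "supp (?f t) = {v \<in> ?V. t v \<noteq> 0}"
      by auto
    then show "supp (?f t) \<in> \<Sigma>" "supp (?f t) \<subseteq> ?V"
      using that unfolding geometric_realization_def by auto
  qed (use that in \<open>auto simp: geometric_realization_def\<close>)
  have g_in: "?g t \<in> {t. (\<forall>v\<in>?V. 0 \<le> t v) \<and> sum t ?V = 1 \<and> {v \<in> ?V. t v \<noteq> 0} \<in> \<Sigma>}"
    if "t \<in> realization \<Sigma>" for t
  proof -
    have "supp t \<subseteq> ?V"
      using realizationD(2)[OF that] by auto
    moreover from this have "{v \<in> ?V. ?g t v \<noteq> 0} = supp t"
      by auto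
    ultimately show ?thesis
      using realizationD(1,2)[OF that] realizationD(3)[OF that assms] by auto
  qed
  have fg: "?f (?g t) = t" if "t \<in> realization \<Sigma>" for t
    using realizationD(2)[OF that] by (auto simp: fun_eq_iff)
  have gf: "?g (?f t) = t" if "t \<in> topspace (geometric_realization \<Sigma>)" for t
    using that by (auto simp: geometric_realization_def PiE_def extensional_def fun_eq_iff)
  have cf: "continuous_map (geometric_realization \<Sigma>) (powertop_real UNIV) ?f"
    unfolding continuous_map_componentwise_UNIV
  proof
    show "continuous_map (geometric_realization \<Sigma>) euclideanreal (\<lambda>t. ?f t v)" for v
      by (cases "v \<in> ?V")
         (auto simp: geometric_realization_def
           intro!: continuous_map_from_subtopology continuous_map_product_projection)
  qed
  have cg: "continuous_map (top_of_set (realization \<Sigma>)) (powertop_real ?V) ?g"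
    unfolding continuous_map_componentwise
    by (auto intro: continuous_on_subset[OF continuous_on_product_coordinates])
  show ?thesis
    unfolding homeomorphic_space_def homeomorphic_maps_def
  proof (rule exI[of _ ?f], rule exI[of _ ?g], intro conjI ballI)
    show "continuous_map (geometric_realization \<Sigma>) (top_of_set (realization \<Sigma>)) ?f"
      using cf f_in by (auto simp: continuous_map_in_subtopology euclidean_product_topology)
    show "continuous_map (top_of_set (realization \<Sigma>)) (geometric_realization \<Sigma>) ?g"
      unfolding geometric_realization_def continuous_map_in_subtopology
      using cg g_in by auto
    show "?g (?f t) = t" if "t \<in> topspace (geometric_realization \<Sigma>)" for t
      by (rule gf[OF that])
    show "?f (?g t) = t" if "t \<in> topspace (top_of_set (realization \<Sigma>))" for t
      by (rule fg) (use that in simp)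
  qed
qed

subsection \<open>Dowker duality\<close>

lemma dowker_Phi_eq_dowker_Psi: "dowker_Phi A B Q = dowker_Psi B A (Q\<inverse>)"
  by (auto simp: dowker_Phi_def dowker_Psi_def)

lemma down_closed_dowker_Psi: "down_closed (dowker_Psi A B Q)"
  unfolding down_closed_def dowker_Psi_def by blast

text \<open>A weight survives only if the mass of \<open>t\<close> outside the column of \<open>y\<close> is below \<open>1 / card A\<close>.
  A coordinate of maximal mass has at least that mass, so the surviving \<open>y\<close> all lie in its row;
  and the surviving weight is maximal exactly if the support of \<open>t\<close> lies in the column of \<open>y\<close>.\<close>

definition dowker_weight :: "'a set \<Rightarrow> 'b set \<Rightarrow> ('a \<times> 'b) set \<Rightarrow> ('a \<Rightarrow> real) \<Rightarrow> 'b \<Rightarrow> real" where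
  "dowker_weight A B Q t y =
     (if y \<in> B then max 0 (1 - real (card A) * (\<Sum>x\<in>{x \<in> A. (x, y) \<notin> Q}. t x)) else 0)"

definition dowker_map :: "'a set \<Rightarrow> 'b set \<Rightarrow> ('a \<times> 'b) set \<Rightarrow> ('a \<Rightarrow> real) \<Rightarrow> 'b \<Rightarrow> real" where
  "dowker_map A B Q t y = dowker_weight A B Q t y / (\<Sum>z\<in>B. dowker_weight A B Q t z)"

lemma exists_ge_average:
  fixes t :: "'a \<Rightarrow> real"
  assumes "finite A" "sum t A = 1"
  obtains x where "x \<in> A" "1 \<le> card A * t x"
proof -
  have "\<exists>x\<in>A. 1 \<le> card A * t x"
  proof (rule ccontr)
    assume "\<not> ?thesis"
    then have *: "\<And>x. x \<in> A \<Longrightarrow> card A * t x < 1"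
      by force
    have "A \<noteq> {}"
      using assms by auto
    with assms have "(\<Sum>x\<in>A. card A * t x) < (\<Sum>x\<in>A. 1)"
      by (intro sum_strict_mono *) auto
    then show False
      using assms by (simp flip: sum_distrib_left)
  qed
  then show thesis
    using that by auto
qed

context
  fixes A :: "'a set" and B :: "'b set" and Q :: "('a \<times> 'b) set"
  assumes finA: "finite A" and finB: "finite B"
begin

lemma dowker_weight_nonneg: "0 \<le> dowker_weight A B Q t y"
  by (simp add: dowker_weight_def)

lemma dowker_weight_eq_1:
  assumes "y \<in> B" "\<forall>x\<in>supp t. (x, y) \<in> Q"
  shows "dowker_weight A B Q t y = 1"
proof -
  have "(\<Sum>x\<in>{x \<in> A. (x, y) \<notin> Q}. t x) = 0"
    by (rule sum.neutral) (use assms in auto)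
  then show ?thesis
    using assms by (simp add: dowker_weight_def)
qed

context
  fixes t
  assumes t: "t \<in> realization (dowker_Psi A B Q)"
begin

lemma supp_subset: "supp t \<subseteq> A"
  using realizationD(2)[OF t] by (auto simp: dowker_Psi_def)

lemma dowker_weight_eq_1_iff:
  assumes "y \<in> B"
  shows "1 \<le> dowker_weight A B Q t y \<longleftrightarrow> (\<forall>x\<in>supp t. (x, y) \<in> Q)"
proof
  assume *: "1 \<le> dowker_weight A B Q t y"
  show "\<forall>x\<in>supp t. (x, y) \<in> Q"
  proof (rule ccontr)
    assume "\<not> ?thesis"
    then obtain x where x: "t x \<noteq> 0" "(x, y) \<notin> Q"
      by auto
    have pos: "0 < t x" "x \<in> A"
      using x realizationD(1)[OF t, of x] supp_subset by auto
    have "t x \<le> (\<Sum>x\<in>{x \<in> A. (x, y) \<notin> Q}. t x)"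
      by (rule member_le_sum) (use x pos finA realizationD(1)[OF t] in auto)
    moreover have "0 < card A"
      using pos finA card_gt_0_iff by blast
    ultimately have "0 < card A * (\<Sum>x\<in>{x \<in> A. (x, y) \<notin> Q}. t x)"
      using pos by simp
    then have "max 0 (1 - card A * (\<Sum>x\<in>{x \<in> A. (x, y) \<notin> Q}. t x)) < 1"
      by linarith
    with * assms show False
      by (simp add: dowker_weight_def)
  qed
next
  assume "\<forall>x\<in>supp t. (x, y) \<in> Q"
  then show "1 \<le> dowker_weight A B Q t y"
    using dowker_weight_eq_1[OF assms] by simp
qed

lemma sum_dowker_weight_pos: "0 < (\<Sum>y\<in>B. dowker_weight A B Q t y)"
proof -
  obtain y where y: "y \<in> B" "\<forall>x\<in>supp t. (x, y) \<in> Q"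
    using realizationD(2)[OF t] by (auto simp: dowker_Psi_def)
  then show ?thesis
    by (intro sum_pos2[OF finB, of y]) (auto simp: dowker_weight_eq_1 dowker_weight_nonneg)
qed

lemma dowker_map_in_realization: "dowker_map A B Q t \<in> realization (dowker_Psi B A (Q\<inverse>))"
proof (rule realizationI[OF finB])
  show "0 \<le> dowker_map A B Q t y" for y
    by (simp add: dowker_map_def dowker_weight_nonneg sum_nonneg)
  show sub: "supp (dowker_map A B Q t) \<subseteq> B"
    by (auto simp: dowker_map_def dowker_weight_def)
  show "sum (dowker_map A B Q t) B = 1"
    using sum_dowker_weight_pos by (simp add: dowker_map_def flip: sum_divide_distrib)
  \<comment> \<open>This \<open>x\<close> is the common witness: a \<open>y\<close> not related to
    it misses mass at least \<open>1 / card A\<close>, so its weight is cut off to 0.\<close>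
  obtain x where x: "x \<in> A" "1 \<le> card A * t x"
    using exists_ge_average[OF finA realizationD(3)[OF t finA supp_subset]] by auto
  have "(x, y) \<in> Q" if y: "y \<in> supp (dowker_map A B Q t)" for y
  proof (rule ccontr)
    assume "(x, y) \<notin> Q"
    then have "t x \<le> (\<Sum>x\<in>{x \<in> A. (x, y) \<notin> Q}. t x)"
      by (intro member_le_sum) (use x finA realizationD(1)[OF t] in auto)
    then have "card A * t x \<le> card A * (\<Sum>x\<in>{x \<in> A. (x, y) \<notin> Q}. t x)"
      by (rule mult_left_mono) simp
    then have "dowker_weight A B Q t y = 0"
      using x by (simp add: dowker_weight_def)
    with y show False
      by (simp add: dowker_map_def)
  qed
  then show "supp (dowker_map A B Q t) \<in> dowker_Psi B A (Q\<inverse>)"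
    using x sub by (auto simp: dowker_Psi_def)
qed

end

lemma continuous_on_dowker_map:
  "continuous_on (realization (dowker_Psi A B Q)) (dowker_map A B Q)"
proof (rule continuous_on_coordinatewise_then_product)
  have w: "continuous_on S (\<lambda>t. dowker_weight A B Q t y)" for S y
    by (cases "y \<in> B") (auto simp: dowker_weight_def intro!: continuous_intros
          intro: continuous_on_subset[OF continuous_on_product_coordinates])
  show "continuous_on (realization (dowker_Psi A B Q)) (\<lambda>t. dowker_map A B Q t y)" for y
    unfolding dowker_map_def
    by (intro continuous_intros w) (use sum_dowker_weight_pos in force)
qed

end

text \<open>The supports of \<open>t\<close> and of its image under the composite lie in one common
  column, that of an element \<open>y\<close> of largest weight, so the segment between the two
  points stays in the realization.\<close>

lemma homotopic_dowker_map_dowker_map: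
  assumes "finite A" "finite B"
  shows "homotopic_with_canon (\<lambda>_. True)
    (realization (dowker_Psi A B Q)) (realization (dowker_Psi A B Q))
    (dowker_map B A (Q\<inverse>) \<circ> dowker_map A B Q) id"
proof (rule homotopic_straight_line)
  let ?P = "dowker_Psi A B Q"
  let ?f = "dowker_map A B Q" and ?g = "dowker_map B A (Q\<inverse>)"
  show "continuous_on (realization ?P) (?g \<circ> ?f)"
    using assms dowker_map_in_realization[OF assms, of _ Q]
    by (intro continuous_on_compose continuous_on_dowker_map
        continuous_on_subset[OF continuous_on_dowker_map]) auto
  show "continuous_on (realization ?P) id"
    by (rule continuous_on_id')
  fix s :: real and t assume s: "s \<in> {0..1}" and t: "t \<in> realization ?P"
  note ft = dowker_map_in_realization[OF assms t]
  have gft: "?g (?f t) \<in> realization ?P"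
    using dowker_map_in_realization[OF assms(2,1) ft] by simp
  obtain y0 where y0: "y0 \<in> B" "\<forall>x\<in>supp t. (x, y0) \<in> Q"
    using realizationD(2)[OF t] by (auto simp: dowker_Psi_def)
  \<comment> \<open>The weight of \<open>y0\<close> is 1, so the largest weight is at least 1, which
    forces \<open>supp t\<close> into the column of \<open>y\<close>.\<close>
  obtain y where y: "y \<in> B" "\<And>z. z \<in> B \<Longrightarrow> dowker_weight A B Q t z \<le> dowker_weight A B Q t y"
    using Max_in[of "dowker_weight A B Q t ` B"] Max_ge[of "dowker_weight A B Q t ` B"] assms(2) y0(1)
    by (smt (verit) empty_iff finite_imageI imageE imageI)
  have "1 \<le> dowker_weight A B Q t y"
    using y(2)[OF y0(1)] dowker_weight_eq_1[OF assms y0] by simp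
  then have ty: "\<forall>x\<in>supp t. (x, y) \<in> Q"
    using dowker_weight_eq_1_iff[OF assms t y(1)] by simp
  \<comment> \<open>Some value of \<open>?f t\<close> is at least the average
    \<open>1 / card B\<close>. Normalizing preserves the order of the weights, so the value at
    \<open>y\<close> is at least as large.\<close>
  obtain y1 where y1: "y1 \<in> B" "1 \<le> card B * ?f t y1"
    using exists_ge_average[OF assms(2) realizationD(3)[OF ft assms(2) supp_subset[OF assms(2,1) ft]]]
    by auto
  have "1 \<le> card B * ?f t y"
  proof -
    have "?f t y1 \<le> ?f t y"
      unfolding dowker_map_def using y(2)[OF y1(1)] sum_dowker_weight_pos[OF assms t]
      by (simp add: divide_right_mono)
    then have "card B * ?f t y1 \<le> card B * ?f t y"
      by (rule mult_left_mono) simp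
    with y1 show ?thesis by simp
  qed
  \<comment> \<open>An \<open>x\<close> unrelated to \<open>y\<close> misses the mass
    \<open>?f t y\<close>, which is already enough for the second map to send its weight to
    0.\<close>
  have gy: "(x, y) \<in> Q" if x: "x \<in> supp (?g (?f t))" for x
  proof (rule ccontr)
    assume "(x, y) \<notin> Q"
    then have "?f t y \<le> (\<Sum>y\<in>{y \<in> B. (y, x) \<notin> Q\<inverse>}. ?f t y)"
      by (intro member_le_sum) (use y(1) assms(2) realizationD(1)[OF ft] in auto)
    then have "card B * ?f t y \<le> card B * (\<Sum>y\<in>{y \<in> B. (y, x) \<notin> Q\<inverse>}. ?f t y)"
      by (rule mult_left_mono) simp
    then have "dowker_weight B A (Q\<inverse>) (?f t) x = 0"
      using \<open>1 \<le> card B * ?f t y\<close> by (simp add: dowker_weight_def)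
    with x show False
      by (simp add: dowker_map_def)
  qed
  have sub: "supp (?g (?f t)) \<subseteq> A" "supp t \<subseteq> A"
    using realizationD(2)[OF t] realizationD(2)[OF gft] by (auto simp: dowker_Psi_def)
  have "supp (?g (?f t)) \<union> supp t \<in> ?P"
    using sub ty gy by (auto simp: dowker_Psi_def intro!: bexI[OF _ y(1)])
  moreover have "finite (supp (?g (?f t)) \<union> supp t)"
    using sub assms(1) finite_subset by blast
  ultimately show "(\<lambda>v. (1 - s) * (?g \<circ> ?f) t v + s * id t v) \<in> realization ?P"
    using segment_in_realization[OF s gft t down_closed_dowker_Psi] by simp
qed

text \<open>Since \<open>dowker_Phi\<close> of a relation is \<open>dowker_Psi\<close> of its
  converse, the two composites are handled by one homotopy, taken for \<open>Q\<close> and for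
  \<open>Q\<inverse>\<close>.\<close>

lemma dowker_duality:
  assumes "finite A" "finite B"
  shows "realization (dowker_Psi A B Q) homotopy_eqv realization (dowker_Phi A B Q)"
  unfolding homotopy_equivalent_space_def dowker_Phi_eq_dowker_Psi
proof (intro exI conjI)
  let ?f = "dowker_map A B Q" and ?g = "dowker_map B A (Q\<inverse>)"
  show "continuous_map (top_of_set (realization (dowker_Psi A B Q)))
      (top_of_set (realization (dowker_Psi B A (Q\<inverse>)))) ?f"
    using continuous_on_dowker_map[OF assms] dowker_map_in_realization[OF assms]
    by (auto simp: continuous_map_subtopology_eu)
  show "continuous_map (top_of_set (realization (dowker_Psi B A (Q\<inverse>))))
      (top_of_set (realization (dowker_Psi A B Q))) ?g"
    using continuous_on_dowker_map[OF assms(2,1), of "Q\<inverse>"]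
      dowker_map_in_realization[OF assms(2,1), of _ "Q\<inverse>"]
    by (auto simp: continuous_map_subtopology_eu)
  show "homotopic_with_canon (\<lambda>_. True) (realization (dowker_Psi A B Q))
      (realization (dowker_Psi A B Q)) (?g \<circ> ?f) id"
    by (rule homotopic_dowker_map_dowker_map[OF assms])
  show "homotopic_with_canon (\<lambda>_. True) (realization (dowker_Psi B A (Q\<inverse>)))
      (realization (dowker_Psi B A (Q\<inverse>))) (?f \<circ> ?g) id"
    using homotopic_dowker_map_dowker_map[OF assms(2,1), of "Q\<inverse>"] by simp
qed

subsection \<open>The boundary of a simplex\<close>

lemma continuous_on_Min:
  fixes f :: "'i \<Rightarrow> 'x::topological_space \<Rightarrow> real"
  assumes "finite I" "I \<noteq> {}" "\<And>i. i \<in> I \<Longrightarrow> continuous_on S (f i)"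
  shows "continuous_on S (\<lambda>x. Min ((\<lambda>i. f i x) ` I))"
  using assms
proof (induction I rule: finite_ne_induct)
  case (insert i I)
  have "continuous_on S (\<lambda>x. min (f i x) (Min ((\<lambda>i. f i x) ` I)))"
    by (intro continuous_intros insert) (use insert in auto)
  then show ?case
    using insert.hyps by simp
qed simp

lemma nsphere_eq_top_of_set:
  "nsphere n = top_of_set {x. (\<Sum>i\<le>n. (x i)\<^sup>2) = 1 \<and> (\<forall>i>n. x i = 0)}"
  by (simp add: nsphere euclidean_product_topology)

text \<open>The homeomorphism projects from the barycentre after forgetting the last of the
  \<open>n + 2\<close> coordinates, which is determined by the others.\<close>

lemma realization_boundary_homeomorphic_nsphere:
  fixes V :: "'a set"
  assumes "card V = n + 2"
  shows "top_of_set (realization (boundary_complex V)) homeomorphic_space nsphere n"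
proof -
  have finV: "finite V"
    using assms by (metis add_2_eq_Suc' card.infinite nat.distinct(1))
  obtain e where "bij_betw e {..<card V} V"
    using ex_bij_betw_nat_finite[OF finV] by (auto simp: atLeast0LessThan)
  then have e: "bij_betw e {..Suc n} V"
    using assms by (simp add: lessThan_Suc_atMost)
  define p where "p = the_inv_into {..Suc n} e"
  have pe: "p (e i) = i" if "i \<le> Suc n" for i
    using that e unfolding p_def by (simp add: bij_betw_def the_inv_into_f_f)
  have ep: "e (p v) = v" and p_le: "p v \<le> Suc n" if "v \<in> V" for v
    using that e f_the_inv_into_f_bij_betw[OF e, of v] bij_betw_the_inv_into[OF e]
    unfolding p_def by (auto simp: bij_betw_def)
  have eV: "e i \<in> V" if "i \<le> Suc n" for i
    using that e by (auto simp: bij_betw_def)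
  have sumV: "sum h V = (\<Sum>i\<le>Suc n. h (e i))" for h :: "'a \<Rightarrow> real"
    using sum.reindex_bij_betw[OF e, of h] by simp
  \<comment> \<open>\<open>c\<close> is the number of vertices, so \<open>1 / c\<close> is each
    coordinate of the barycentre and \<open>u t\<close> below is the displacement of
    \<open>t\<close> from it.\<close>
  define c :: real where "c = real n + 2"
  have c: "0 < c"
    by (simp add: c_def)
  let ?B = "realization (boundary_complex V)"
  let ?S = "{x. (\<Sum>i\<le>n. (x i)\<^sup>2) = 1 \<and> (\<forall>i>n. x i = 0)} :: (nat \<Rightarrow> real) set"
  define u where "u t i = t (e i) - 1 / c" for t i
  define N where "N t = sqrt (\<Sum>i\<le>n. (u t i)\<^sup>2)" for t
  define f where "f t i = (if i \<le> n then u t i / N t else 0)" for t i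
  \<comment> \<open>The forgotten last coordinate is restored by requiring that a displacement
    within the simplex has coordinate sum 0.\<close>
  define X where "X x i = (if i \<le> n then x i else - (\<Sum>j\<le>n. x j))" for x :: "nat \<Rightarrow> real" and i
  define m where "m x = Min ((\<lambda>i. X x i) ` {..Suc n})" for x
  \<comment> \<open>The ray with coordinates \<open>1 / c + s * X x i\<close> leaves the simplex
    when its smallest coordinate reaches 0, that is at \<open>s = - 1 / (c * m x)\<close>.\<close>
  define g where "g x v = (if v \<in> V then (1 - X x (p v) / m x) / c else 0)" for x v
  have sum_u: "(\<Sum>i\<le>n. u t i) = - u t (Suc n)" if "t \<in> ?B" for t
  proof -
    have "sum t V = 1"
      using realizationD(2,3)[OF that] finV by (auto simp: boundary_complex_def)
    then have "(\<Sum>i\<le>n. t (e i)) + t (e (Suc n)) = 1"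
      by (simp add: sumV)
    moreover have "(\<Sum>i\<le>n. u t i) = (\<Sum>i\<le>n. t (e i)) - (real n + 1) / c"
      by (simp add: u_def sum_subtractf)
    moreover have "(real n + 1) / c = 1 - 1 / c"
      using c by (simp add: c_def field_simps)
    ultimately show ?thesis
      by (simp add: u_def)
  qed
  have zero: "\<exists>i\<le>Suc n. t (e i) = 0" if "t \<in> ?B" for t
  proof -
    obtain v where "v \<in> V" "t v = 0"
      using realizationD(2)[OF \<open>t \<in> ?B\<close>] by (auto simp: boundary_complex_def)
    then show ?thesis
      using ep p_le by metis
  qed
  have N: "0 < N t" if "t \<in> ?B" for t
  proof -
    obtain i where i: "i \<le> Suc n" "t (e i) = 0"
      using zero[OF \<open>t \<in> ?B\<close>] by auto
    \<comment> \<open>If the first \<open>n + 1\<close> displacements vanished, so would the last,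
      which is minus their sum. But a boundary point has a coordinate 0, where the displacement is
      \<open>- 1 / c\<close>.\<close>
    have "(\<Sum>i\<le>n. (u t i)\<^sup>2) \<noteq> 0"
    proof
      assume "(\<Sum>i\<le>n. (u t i)\<^sup>2) = 0"
      then have *: "u t j = 0" if "j \<le> n" for j
        using that by (simp add: sum_nonneg_eq_0_iff)
      then have "u t (Suc n) = 0"
        using sum_u[OF \<open>t \<in> ?B\<close>] by simp
      with * i have "u t i = 0"
        by (cases "i = Suc n") auto
      then show False
        using i c by (simp add: u_def)
    qed
    then show ?thesis
      unfolding N_def by (simp add: sum_nonneg less_le)
  qed
  have sum_X: "(\<Sum>i\<le>Suc n. X x i) = 0" for x
    by (simp add: X_def)
  have m_le: "m x \<le> X x i" if "i \<le> Suc n" for x i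
    unfolding m_def by (rule Min_le) (use that in auto)
  have m_attained: "\<exists>i\<le>Suc n. m x = X x i" for x
  proof -
    have "m x \<in> (\<lambda>i. X x i) ` {..Suc n}"
      unfolding m_def by (rule Min_in) auto
    then show ?thesis
      by (metis atMost_iff imageE)
  qed
  \<comment> \<open>The coordinates of \<open>X x\<close> sum to 0; if none were negative, all would
    vanish, which is impossible on the sphere.\<close>
  have m: "m x < 0" if "x \<in> ?S" for x
  proof (rule ccontr)
    assume "\<not> m x < 0"
    then have "0 \<le> X x i" if "i \<le> Suc n" for i
      using m_le[OF that, of x] by linarith
    then have X0: "\<forall>i\<in>{..Suc n}. X x i = 0"
      using sum_X[of x] by (subst (asm) sum_nonneg_eq_0_iff) auto
    have "x i = 0" if "i \<le> n" for i
    proof -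
      have "X x i = 0"
        using X0 that by simp
      then show ?thesis
        using that by (simp add: X_def)
    qed
    then show False
      using \<open>x \<in> ?S\<close> by simp
  qed
  have f_in: "f t \<in> ?S" if "t \<in> ?B" for t
  proof -
    have "(\<Sum>i\<le>n. (f t i)\<^sup>2) = (\<Sum>i\<le>n. (u t i)\<^sup>2) / (N t)\<^sup>2"
      by (simp add: f_def power_divide sum_divide_distrib)
    also have "\<dots> = 1"
    proof -
      have "(N t)\<^sup>2 = (\<Sum>i\<le>n. (u t i)\<^sup>2)"
        unfolding N_def by (simp add: sum_nonneg)
      then show ?thesis
        using N[OF that] by auto
    qed
    finally show ?thesis
      by (simp add: f_def)
  qed
  have g_in: "g x \<in> ?B" if x: "x \<in> ?S" for x
  proof (rule realizationI[OF finV])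
    show "0 \<le> g x v" for v
      using m_le[OF p_le, of v x] m[OF x] c by (simp add: g_def divide_le_eq_1)
    show sub: "supp (g x) \<subseteq> V"
      by (auto simp: g_def)
    obtain i where i: "i \<le> Suc n" "m x = X x i"
      using m_attained by auto
    then have "g x (e i) = 0"
      using m[OF x] by (simp add: g_def pe)
    then show "supp (g x) \<in> boundary_complex V"
      using sub eV[OF i(1)] by (auto simp: boundary_complex_def)
    have "sum (g x) V = (\<Sum>i\<le>Suc n. (1 - X x i / m x) / c)"
      unfolding sumV by (rule sum.cong) (use eV pe in \<open>auto simp: g_def\<close>)
    also have "\<dots> = ((\<Sum>i\<le>Suc n. 1) - (\<Sum>i\<le>Suc n. X x i) / m x) / c"
      by (simp only: sum_subtractf flip: sum_divide_distrib)
    also have "\<dots> = 1"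
      using c unfolding sum_X by (simp add: c_def)
    finally show "sum (g x) V = 1" .
  qed
  have gf: "g (f t) = t" if t: "t \<in> ?B" for t
  proof -
    have X: "X (f t) i = u t i / N t" if "i \<le> Suc n" for i
      using that sum_u[OF t] by (cases "i = Suc n") (auto simp: X_def f_def simp flip: sum_divide_distrib)
    \<comment> \<open>Every displacement is at least \<open>- 1 / c\<close>, with equality at a
      vanishing coordinate of \<open>t\<close>.\<close>
    have "m (f t) = - 1 / (c * N t)"
      unfolding m_def
    proof (rule Min_eqI)
      fix y assume "y \<in> X (f t) ` {..Suc n}"
      then obtain i where i: "i \<le> Suc n" "y = u t i / N t"
        using X by auto
      have "- 1 / c \<le> u t i"
        using realizationD(1)[OF t] by (simp add: u_def)
      then have "- 1 / c / N t \<le> u t i / N t"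
        using N[OF t] by (intro divide_right_mono) auto
      then show "- 1 / (c * N t) \<le> y"
        using i by simp
    next
      obtain i where i: "i \<le> Suc n" "t (e i) = 0"
        using zero[OF t] by auto
      show "- 1 / (c * N t) \<in> X (f t) ` {..Suc n}"
        by (rule image_eqI[of _ _ i]) (use i X in \<open>auto simp: u_def\<close>)
    qed simp
    then have "g (f t) v = (1 + c * u t (p v)) / c" if "v \<in> V" for v
      using that X[OF p_le[OF that]] N[OF t] c by (simp add: g_def)
    then have "g (f t) v = t v" if "v \<in> V" for v
      using that c by (simp add: u_def ep field_simps)
    moreover have "t v = 0" if "v \<notin> V" for v
      using realizationD(2)[OF t] that by (auto simp: boundary_complex_def)
    ultimately show ?thesis
      by (auto simp: fun_eq_iff g_def)
  qed
  have fg: "f (g x) = x" if x: "x \<in> ?S" for x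
  proof -
    have u: "u (g x) i = x i / (- m x * c)" if "i \<le> n" for i
      using that eV[of i] c m[OF x] by (simp add: u_def g_def pe X_def field_simps)
    have "(\<Sum>i\<le>n. (u (g x) i)\<^sup>2) = (\<Sum>i\<le>n. (x i)\<^sup>2) / (- m x * c)\<^sup>2"
      using u by (simp add: power_divide sum_divide_distrib)
    also have "\<dots> = (1 / (- m x * c))\<^sup>2"
      using x by (simp add: power_divide)
    finally have "N (g x) = 1 / (- m x * c)"
      using m[OF x] c unfolding N_def by (simp add: real_sqrt_abs abs_mult)
    then have "f (g x) i = x i" if "i \<le> n" for i
      using that u[OF that] m[OF x] c by (simp add: f_def)
    then show ?thesis
      using x by (auto simp: fun_eq_iff f_def)
  qed
  have cont_u: "continuous_on A (\<lambda>t. u t i)" for A i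
    unfolding u_def
    by (intro continuous_intros continuous_on_subset[OF continuous_on_product_coordinates]) auto
  have cont_N: "continuous_on A N" for A
    unfolding N_def by (intro continuous_intros cont_u)
  have "continuous_on ?B (\<lambda>t. f t i)" for i
    unfolding f_def
    by (cases "i \<le> n") (use N in \<open>force intro!: continuous_intros cont_u cont_N\<close>)+
  then have cont_f: "continuous_on ?B f"
    by (rule continuous_on_coordinatewise_then_product)
  have cont_X: "continuous_on A (\<lambda>x. X x i)" for A i
    unfolding X_def
    by (cases "i \<le> n")
       (auto intro!: continuous_intros continuous_on_subset[OF continuous_on_product_coordinates])
  have "continuous_on ?S (\<lambda>x. g x v)" for v
  proof (cases "v \<in> V")
    case True
    have "continuous_on ?S m"
      unfolding m_def by (rule continuous_on_Min) (auto intro: cont_X)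
    moreover have "\<forall>x\<in>?S. m x \<noteq> 0"
      using m by force
    ultimately show ?thesis
      using True c by (simp add: g_def continuous_intros cont_X)
  qed (simp add: g_def)
  then have cont_g: "continuous_on ?S g"
    by (rule continuous_on_coordinatewise_then_product)
  show ?thesis
    unfolding nsphere_eq_top_of_set homeomorphic_space_def homeomorphic_maps_def
    by (rule exI[of _ f], rule exI[of _ g])
       (use cont_f cont_g f_in g_in fg gf in \<open>auto simp: continuous_map_subtopology_eu\<close>)
qed

subsection \<open>Removing a maximal face\<close>

lemma trivial_reduced_homology_homotopy_invariant:
  assumes "X homotopy_equivalent_space Y" "trivial_group (reduced_homology_group p Y)"
  shows "trivial_group (reduced_homology_group p X)"
  using assms(2) isomorphic_group_triviality
    [OF homotopy_equivalent_space_imp_isomorphic_reduced_homology_groups[OF assms(1)]]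
  by simp

definition barycentre :: "'a set \<Rightarrow> 'a \<Rightarrow> real" where
  "barycentre \<tau> v = (if v \<in> \<tau> then 1 / card \<tau> else 0)"

definition min_coord :: "'a set \<Rightarrow> ('a \<Rightarrow> real) \<Rightarrow> real" where
  "min_coord \<tau> t = Min (t ` \<tau>)"

text \<open>On the interior of the face \<open>\<tau>\<close> this is the radial projection from the barycentre to the
  boundary; it fixes all points with a vanishing coordinate in \<open>\<tau>\<close>.\<close>

definition push_out :: "'a set \<Rightarrow> ('a \<Rightarrow> real) \<Rightarrow> 'a \<Rightarrow> real" where
  "push_out \<tau> t v = (t v - (if v \<in> \<tau> then min_coord \<tau> t else 0)) / (1 - card \<tau> * min_coord \<tau> t)"

section \<open>Radial projection from the barycentre of a maximal face\<close>

locale maximal_face =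
  fixes L :: "'a set set" and \<tau> :: "'a set"
  assumes finite_vertices: "finite (\<Union>L)"
    and down_closed: "down_closed L"
    and face: "\<tau> \<in> L" and nonempty: "\<tau> \<noteq> {}"
    and maximal: "\<And>\<tau>'. \<tau>' \<in> L \<Longrightarrow> \<tau> \<subseteq> \<tau>' \<Longrightarrow> \<tau>' = \<tau>"
begin

abbreviation "b \<equiv> barycentre \<tau>"
abbreviation "\<mu> \<equiv> min_coord \<tau>"
abbreviation "r \<equiv> push_out \<tau>"
abbreviation "c \<equiv> real (card \<tau>)"

lemma face_subset_vertices: "\<tau>' \<in> L \<Longrightarrow> \<tau>' \<subseteq> \<Union>L"
  by blast

lemma finite_faces: "\<tau>' \<in> L \<Longrightarrow> finite \<tau>'"
  using face_subset_vertices finite_vertices finite_subset by metis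

lemma finite_face: "finite \<tau>"
  using face finite_faces by blast

lemma c_pos: "0 < c"
  using finite_face nonempty by (simp add: card_gt_0_iff)

lemma min_coord_le: "v \<in> \<tau> \<Longrightarrow> \<mu> t \<le> t v"
  unfolding min_coord_def using finite_face by simp

lemma min_coord_attained: "\<exists>v\<in>\<tau>. \<mu> t = t v"
proof -
  have "\<mu> t \<in> t ` \<tau>"
    unfolding min_coord_def using finite_face nonempty by (intro Min_in) auto
  then show ?thesis
    by auto
qed

lemma less_min_coord_iff: "a < \<mu> t \<longleftrightarrow> (\<forall>v\<in>\<tau>. a < t v)"
  unfolding min_coord_def using finite_face nonempty by simp

lemma sum_vertices: "t \<in> realization L \<Longrightarrow> sum t (\<Union>L) = 1"
  using realizationD(2,3) finite_vertices face_subset_vertices by metis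

lemma sum_if_face: "(\<Sum>v\<in>\<Union>L. if v \<in> \<tau> then a else 0) = c * a"
proof -
  have "\<Union>L \<inter> \<tau> = \<tau>"
    using face by blast
  then show ?thesis
    using finite_vertices by (simp add: sum.If_cases flip: Int_def)
qed

lemma barycentre_in_realization: "b \<in> realization L"
proof (rule realizationI[OF finite_vertices])
  have "supp b = \<tau>"
    using c_pos by (auto simp: barycentre_def)
  then show "supp b \<in> L" "supp b \<subseteq> \<Union>L"
    using face by auto
  show "sum b (\<Union>L) = 1"
    using c_pos unfolding barycentre_def sum_if_face by simp
qed (simp add: barycentre_def)

lemma min_coord_barycentre: "\<mu> b = 1 / c"
  using min_coord_attained[of b] by (auto simp: barycentre_def)

context
  fixes t
  assumes t: "t \<in> realization L"
begin

lemma min_coord_nonneg: "0 \<le> \<mu> t"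
  using min_coord_attained[of t] realizationD(1)[OF t] by auto

text \<open>If the minimum were at least \<open>1 / c\<close>, then \<open>t\<close> would dominate
  \<open>b\<close> in every coordinate; as both have total mass 1, they would coincide.\<close>

lemma min_coord_less:
  assumes "t \<noteq> b"
  shows "\<mu> t < 1 / c"
proof (rule ccontr)
  assume "\<not> \<mu> t < 1 / c"
  then have ge: "b v \<le> t v" for v
    using min_coord_le[of v t] realizationD(1)[OF t, of v] by (auto simp: barycentre_def)
  have "(\<Sum>v\<in>\<Union>L. t v - b v) = 0"
    using sum_vertices[OF t] sum_vertices[OF barycentre_in_realization] by (simp add: sum_subtractf)
  then have eq: "t v = b v" if "v \<in> \<Union>L" for v
    using that ge finite_vertices by (subst (asm) sum_nonneg_eq_0_iff) auto
  have "t v = b v" if "v \<notin> \<Union>L" for v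
  proof -
    have "v \<notin> supp t" "v \<notin> supp b"
      using that realizationD(2)[OF t] realizationD(2)[OF barycentre_in_realization] by blast+
    then show ?thesis by simp
  qed
  with eq have "t v = b v" for v
    by (cases "v \<in> \<Union>L")
  then have "t = b"
    by (rule ext)
  with assms show False ..
qed

text \<open>A positive minimum puts \<tau> inside the support, and maximality makes the two equal.
  Hence the open face is cut out by a single inequality.\<close>

lemma min_coord_pos_imp: "0 < \<mu> t \<Longrightarrow> supp t = \<tau>"
  by (rule maximal) (use realizationD(2)[OF t] less_min_coord_iff[of 0 t] in auto)

text \<open>Subtracting the minimum annihilates a coordinate in \<tau>, so the support is no longer
  \<tau>. The divisor restores total mass 1 and is positive away from the barycentre.\<close>

lemma push_out_in_realization:
  assumes "t \<noteq> b"
  shows "r t \<in> realization (L - {\<tau>})"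
proof (rule realizationI[OF finite_vertices])
  have pos: "0 < 1 - c * \<mu> t"
    using min_coord_less[OF assms] c_pos by (simp add: field_simps)
  show "0 \<le> r t v" for v
    using pos min_coord_le[of v t] realizationD(1)[OF t, of v] by (simp add: push_out_def)
  have sub_t: "supp (r t) \<subseteq> supp t"
  proof
    fix v assume "v \<in> supp (r t)"
    moreover have "\<mu> t = 0" if "v \<in> \<tau>" "t v = 0"
      using min_coord_le[OF that(1), of t] min_coord_nonneg that by simp
    ultimately show "v \<in> supp t"
      by (auto simp: push_out_def split: if_splits)
  qed
  have "supp (r t) \<in> L"
    using down_closedD[OF down_closed realizationD(2)[OF t] sub_t] .
  moreover obtain v where "v \<in> \<tau>" "\<mu> t = t v"
    using min_coord_attained by auto
  then have "v \<in> \<tau> - supp (r t)"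
    by (simp add: push_out_def)
  ultimately show "supp (r t) \<in> L - {\<tau>}"
    by auto
  then show "supp (r t) \<subseteq> \<Union>L"
    by blast
  have "sum (r t) (\<Union>L) = (sum t (\<Union>L) - (\<Sum>v\<in>\<Union>L. if v \<in> \<tau> then \<mu> t else 0)) / (1 - c * \<mu> t)"
    unfolding push_out_def by (simp only: sum_subtractf flip: sum_divide_distrib)
  also have "\<dots> = 1"
    unfolding sum_if_face sum_vertices[OF t] using pos by simp
  finally show "sum (r t) (\<Union>L) = 1" .
qed

end

lemma push_out_eq_self:
  assumes "t \<in> realization (L - {\<tau>})"
  shows "r t = t"
proof -
  have t: "t \<in> realization L" and "supp t \<noteq> \<tau>"
    using assms by (auto simp: realization_def)
  then have "\<mu> t = 0"
    using min_coord_pos_imp[OF t] min_coord_nonneg[OF t] by fastforce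
  then show ?thesis
    by (simp add: push_out_def fun_eq_iff)
qed

lemma continuous_on_min_coord: "continuous_on S \<mu>"
  unfolding min_coord_def
  by (rule continuous_on_Min[OF finite_face nonempty])
     (rule continuous_on_subset[OF continuous_on_product_coordinates], simp)

lemma continuous_on_push_out: "continuous_on (realization L - {b}) r"
proof (rule continuous_on_coordinatewise_then_product)
  have "continuous_on S (\<lambda>t. if v \<in> \<tau> then \<mu> t else 0)" for v and S :: "('a \<Rightarrow> real) set"
    by (cases "v \<in> \<tau>") (auto intro: continuous_on_min_coord)
  moreover have "1 - c * \<mu> t \<noteq> 0" if "t \<in> realization L - {b}" for t
    using that min_coord_less[of t] c_pos by (auto simp: field_simps)
  ultimately show "continuous_on (realization L - {b}) (\<lambda>t. r t v)" for v
    unfolding push_out_def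
    by (intro continuous_intros continuous_on_min_coord
        continuous_on_subset[OF continuous_on_product_coordinates]) auto
qed

lemma realization_minus_face_subset: "realization (L - {\<tau>}) \<subseteq> realization L - {b}"
proof -
  have "supp b = \<tau>"
    using c_pos by (auto simp: barycentre_def)
  then show ?thesis
    by (auto simp: realization_def)
qed

lemma punctured_homotopy_eqv: "realization L - {b} homotopy_eqv realization (L - {\<tau>})"
proof (rule deformation_retract_imp_homotopy_equivalent_space)
  let ?A = "realization L - {b}" and ?K = "realization (L - {\<tau>})"
  show "retraction_maps (top_of_set ?A) (top_of_set ?K) r id"
    unfolding retraction_maps_def
    using continuous_on_push_out push_out_in_realization push_out_eq_self
      realization_minus_face_subset
    by (auto simp: continuous_map_subtopology_eu)
  show "homotopic_with_canon (\<lambda>_. True) ?A ?A r id"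
  proof (rule homotopic_straight_line[OF continuous_on_push_out continuous_on_id'])
    fix s :: real and t assume s: "s \<in> {0..1}" and tA: "t \<in> ?A"
    then have t: "t \<in> realization L" and "t \<noteq> b"
      by auto
    have rt: "r t \<in> realization L"
      using push_out_in_realization[OF t \<open>t \<noteq> b\<close>] realization_minus_face_subset by auto
    have sub_t: "supp (r t) \<union> supp t = supp t"
    proof -
      have "r t v = 0" if "t v = 0" for v
        using that min_coord_le[of v t] min_coord_nonneg[OF t] by (auto simp: push_out_def)
      then show ?thesis by auto
    qed
    let ?w = "\<lambda>v. (1 - s) * r t v + s * t v"
    have "?w \<in> realization L"
      by (rule segment_in_realization[OF s rt t down_closed])
         (use sub_t realizationD(2)[OF t] finite_faces in auto)
    moreover have "?w \<noteq> b"
    proof -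
      \<comment> \<open>At a minimal coordinate the projection is 0, so there the whole segment
        stays below \<open>1 / c\<close>, the value of the barycentre.\<close>
      obtain v where v: "v \<in> \<tau>" "\<mu> t = t v"
        using min_coord_attained by auto
      then have "?w v = s * \<mu> t"
        by (simp add: push_out_def)
      also have "\<dots> \<le> 1 * \<mu> t"
        by (rule mult_right_mono) (use s min_coord_nonneg[OF t] in auto)
      also have "\<dots> < b v"
        using min_coord_less[OF t \<open>t \<noteq> b\<close>] v by (simp add: barycentre_def)
      finally have "?w v \<noteq> b v"
        by simp
      then show ?thesis
        by metis
    qed
    ultimately show "(\<lambda>v. (1 - s) * r t v + s * id t v) \<in> ?A"
      by simp
  qed
qed

section \<open>The core of the face, excision and the effect on reduced homology\<close>

text \<open>Excising the points with \<open>min_coord \<tau> t \<le> 1 / (2 * card \<tau>)\<close> from the pair of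
  \<open>realization L\<close> and its complement of the barycentre leaves the pair of \<open>core\<close> and its
  complement of the barycentre, which only depends on \<open>\<tau>\<close>.\<close>

definition core :: "('a \<Rightarrow> real) set" where
  "core = {t \<in> realization L. 1 / (2 * c) < \<mu> t}"

lemma coreD:
  assumes "t \<in> core"
  shows "t \<in> realization L" "supp t = \<tau>"
proof -
  have "0 < 1 / (2 * c)"
    using c_pos by simp
  also have "\<dots> < \<mu> t"
    using assms by (simp add: core_def)
  finally have "0 < \<mu> t" .
  then show "t \<in> realization L" "supp t = \<tau>"
    using assms min_coord_pos_imp[of t] by (simp_all add: core_def)
qed

lemma barycentre_in_core: "b \<in> core"
  using barycentre_in_realization min_coord_barycentre c_pos by (simp add: core_def field_simps)

lemma segment_in_core:
  assumes "s \<in> {0..1}" "t \<in> core" "u \<in> core"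
  shows "(\<lambda>v. (1 - s) * t v + s * u v) \<in> core"
proof -
  have "(\<lambda>v. (1 - s) * t v + s * u v) \<in> realization L"
    by (rule segment_in_realization[OF assms(1) coreD(1)[OF assms(2)] coreD(1)[OF assms(3)] down_closed])
       (use coreD(2)[OF assms(2)] coreD(2)[OF assms(3)] face finite_face in auto)
  moreover have "1 / (2 * c) < (1 - s) * t v + s * u v" if "v \<in> \<tau>" for v
  proof -
    have "1 / (2 * c) < t v" "1 / (2 * c) < u v"
      using assms(2,3) that by (auto simp: core_def less_min_coord_iff)
    then show ?thesis
      \<comment> \<open>Signs are reversed because \<open>convex_bound_lt\<close> bounds a convex
        combination from above.\<close>
      using convex_bound_lt[of "- t v" "- (1 / (2 * c))" "- u v" "1 - s" s] assms(1) by simp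
  qed
  ultimately show ?thesis
    by (simp add: core_def less_min_coord_iff)
qed

lemma contractible_core: "contractible_space (top_of_set core)"
  unfolding contractible_space_def
  by (intro exI[of _ b] homotopic_straight_line)
     (auto intro: continuous_on_id' segment_in_core barycentre_in_core)

text \<open>The radial projection \<open>r\<close> is inverted up to homotopy by \<open>j\<close>,
  which places a shrunken copy of the boundary around the barycentre.\<close>

lemma punctured_core_homotopy_eqv:
  "core - {b} homotopy_eqv realization (boundary_complex \<tau>)"
proof -
  let ?D = "realization (boundary_complex \<tau>)"
  \<comment> \<open>The weight 3/4 gives \<open>j t\<close> the minimal coordinate
    \<open>3 / (4 * c)\<close>, strictly between the core threshold \<open>1 / (2 * c)\<close> and
    the value \<open>1 / c\<close> at the barycentre.\<close>
  define j where "j t v = (t v + 3 * b v) / 4" for t v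
  have D: "?D \<subseteq> realization (L - {\<tau>})"
    using down_closedD[OF down_closed face] by (auto simp: realization_def boundary_complex_def)
  have min_D: "\<mu> t = 0" if "t \<in> ?D" for t
  proof -
    have t: "t \<in> realization L"
      using that D by (auto simp: realization_def)
    have "supp t \<noteq> \<tau>"
      using realizationD(2)[OF that] by (auto simp: boundary_complex_def)
    then show ?thesis
      using min_coord_pos_imp[OF t] min_coord_nonneg[OF t] by fastforce
  qed
  have r_in: "r t \<in> ?D" if "t \<in> core - {b}" for t
  proof -
    have t: "t \<in> realization L" "t \<noteq> b" "supp t = \<tau>"
      using that coreD by auto
    note rt = push_out_in_realization[OF t(1,2)]
    have "supp (r t) \<subseteq> \<tau>"
      using t(3) by (auto simp: push_out_def)
    then have "supp (r t) \<in> boundary_complex \<tau>"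
      using realizationD(2)[OF rt] by (auto simp: boundary_complex_def)
    then show ?thesis
      using rt by (simp add: realization_def)
  qed
  have j_bound: "3 / (4 * c) \<le> j t v" if "v \<in> \<tau>" "t \<in> ?D" for t v
    using that realizationD(1)[OF that(2), of v] by (simp add: j_def barycentre_def)
  have j_attained: "\<exists>v\<in>\<tau>. t v = 0 \<and> j t v = 3 / (4 * c)" if "t \<in> ?D" for t
    using min_D[OF that] min_coord_attained[of t] by (auto simp: j_def barycentre_def)
  have j_in: "j t \<in> core - {b}" if t: "t \<in> ?D" for t
  proof -
    have tL: "t \<in> realization L"
      using t D by (auto simp: realization_def)
    have "(\<lambda>v. (1 - 3 / 4) * t v + 3 / 4 * b v) \<in> realization L"
    proof (rule segment_in_realization[OF _ tL barycentre_in_realization down_closed])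
      have "supp t \<union> supp b = \<tau>"
        using realizationD(2)[OF t] c_pos by (auto simp: boundary_complex_def barycentre_def)
      then show "supp t \<union> supp b \<in> L" "finite (supp t \<union> supp b)"
        using face finite_face by auto
    qed auto
    moreover have "(\<lambda>v. (1 - 3 / 4) * t v + 3 / 4 * b v) = j t"
      by (simp add: j_def fun_eq_iff field_simps)
    moreover have "1 / (2 * c) < \<mu> (j t)"
    proof -
      have "1 / (2 * c) < 3 / (4 * c)"
        using c_pos by (simp add: field_simps)
      then show ?thesis
        using j_bound[OF _ t] unfolding less_min_coord_iff by (meson less_le_trans)
    qed
    moreover have "j t \<noteq> b"
    proof -
      obtain v where "v \<in> \<tau>" "j t v = 3 / (4 * c)"
        using j_attained[OF t] by auto
      then have "j t v \<noteq> b v"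
        using c_pos by (simp add: barycentre_def field_simps)
      then show ?thesis by auto
    qed
    ultimately show ?thesis
      by (simp add: core_def)
  qed
  have min_j: "\<mu> (j t) = 3 / (4 * c)" if t: "t \<in> ?D" for t
  proof (rule antisym)
    show "\<mu> (j t) \<le> 3 / (4 * c)"
      using j_attained[OF t] min_coord_le[of _ "j t"] by force
    show "3 / (4 * c) \<le> \<mu> (j t)"
      using min_coord_attained[of "j t"] j_bound[OF _ t] by auto
  qed
  have rj: "r (j t) = t" if t: "t \<in> ?D" for t
  proof
    fix v
    show "r (j t) v = t v"
      unfolding push_out_def min_j[OF t] using c_pos
      by (simp add: j_def barycentre_def add_divide_distrib)
  qed
  have cont_r: "continuous_on (core - {b}) r"
    by (rule continuous_on_subset[OF continuous_on_push_out]) (auto simp: core_def)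
  have cont_j: "continuous_on S j" for S
    unfolding j_def
    by (intro continuous_on_coordinatewise_then_product continuous_intros
        continuous_on_subset[OF continuous_on_product_coordinates]) auto
  have jr: "homotopic_with_canon (\<lambda>_. True) (core - {b}) (core - {b}) (j \<circ> r) id"
  proof (rule homotopic_straight_line[OF _ continuous_on_id'])
    show "continuous_on (core - {b}) (j \<circ> r)"
      by (intro continuous_on_compose cont_r cont_j)
    fix s :: real and t assume s: "s \<in> {0..1}" and t: "t \<in> core - {b}"
    note D = r_in[OF t]
    let ?w = "\<lambda>v. (1 - s) * j (r t) v + s * t v"
    have "?w \<in> core"
      by (rule segment_in_core[OF s]) (use t j_in[OF D] in auto)
    moreover have "?w \<noteq> b"
    proof -
      \<comment> \<open>At a minimal coordinate of \<open>t\<close> both ends of the segment are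
        below \<open>1 / c\<close>, so the segment misses the barycentre.\<close>
      obtain v where v: "v \<in> \<tau>" "\<mu> t = t v"
        using min_coord_attained by auto
      have tv: "t v < 1 / c"
        using min_coord_less[of t] t v by (auto simp: core_def)
      have "j (r t) v = 3 / (4 * c)"
        using v by (simp add: j_def push_out_def barycentre_def)
      also have "\<dots> < 1 / c"
        using c_pos by (simp add: field_simps)
      finally have "?w v < 1 / c"
        using tv s convex_bound_lt[of "j (r t) v" "1 / c" "t v" "1 - s" s] by simp
      then have "?w v \<noteq> b v"
        using v by (simp add: barycentre_def)
      then show ?thesis
        by metis
    qed
    ultimately show "(\<lambda>v. (1 - s) * (j \<circ> r) t v + s * id t v) \<in> core - {b}"
      by simp
  qed
  have "homotopic_with_canon (\<lambda>_. True) ?D ?D (r \<circ> j) id"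
    by (rule homotopic_with_equal) (use rj in \<open>auto intro: continuous_on_id'\<close>)
  then show ?thesis
    unfolding homotopy_equivalent_space_def
    using jr cont_r cont_j r_in j_in
    by (intro exI[of _ r] exI[of _ j]) (auto simp: continuous_map_subtopology_eu)
qed

text \<open>As the core is contractible, this group is the reduced homology in degree
  \<open>n\<close> of the punctured core, hence of a sphere of dimension
  \<open>card \<tau> - 2\<close>, which is less than \<open>n\<close>. For a vertex \<tau> that
  sphere is empty.\<close>

lemma trivial_relative_homology_core:
  assumes "card \<tau> \<le> n + 1"
  shows "trivial_group (relative_homology_group (int n + 1) (top_of_set core) (core - {b}))"
proof (cases "core - {b} = {}")
  case True
  \<comment> \<open>Relative to the empty set the group is absolute homology, which agrees with
    reduced homology because the degree \<open>n + 1\<close> is not 0.\<close>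
  have "trivial_group (homology_group (int n + 1) (top_of_set core))"
    using trivial_reduced_homology_group_contractible_space[OF contractible_core, of "int n + 1"]
    by (simp add: un_reduced_homology_group)
  then show ?thesis
    by (simp only: True)
next
  case False
  let ?D = "realization (boundary_complex \<tau>)"
  have "trivial_group (reduced_homology_group (int n) (top_of_set ?D))"
  proof (cases "card \<tau> = 1")
    case True
    then have "boundary_complex \<tau> = {{}}"
      by (auto simp: card_1_singleton_iff boundary_complex_def)
    then have "?D = {}"
      by (auto simp: realization_def)
    then show ?thesis
      by (simp add: trivial_reduced_homology_group_empty)
  next
    case False
    then have "card \<tau> = (card \<tau> - 2) + 2"
      using c_pos by simp
    then have "top_of_set ?D homotopy_equivalent_space nsphere (card \<tau> - 2)"
      by (intro homeomorphic_imp_homotopy_equivalent_space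
          realization_boundary_homeomorphic_nsphere)
    moreover have "trivial_group (reduced_homology_group (int n) (nsphere (card \<tau> - 2)))"
      using assms False c_pos by (intro reduced_homology_group_nsphere(2)) linarith
    ultimately show ?thesis
      by (rule trivial_reduced_homology_homotopy_invariant)
  qed
  then have *: "trivial_group (reduced_homology_group (int n) (top_of_set (core - {b})))"
    by (rule trivial_reduced_homology_homotopy_invariant[OF punctured_core_homotopy_eqv])
  have "subtopology (top_of_set core) (core - {b}) = top_of_set (core - {b})"
    by (simp add: subtopology_subtopology Int_absorb1)
  moreover have "relative_homology_group (int n + 1) (top_of_set core) (core - {b}) \<cong>
      reduced_homology_group (int n + 1 - 1) (subtopology (top_of_set core) (core - {b}))"
    by (rule isomorphic_group_relative_homology_of_contractible[OF contractible_core])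
       (use False in auto)
  ultimately have "relative_homology_group (int n + 1) (top_of_set core) (core - {b}) \<cong>
      reduced_homology_group (int n) (top_of_set (core - {b}))"
    by simp
  then show ?thesis
    using * isomorphic_group_triviality[OF _ group_relative_homology_group group_reduced_homology_group]
    by blast
qed

lemma trivial_relative_homology_punctured:
  assumes "card \<tau> \<le> n + 1"
  shows "trivial_group
    (relative_homology_group (int n + 1) (top_of_set (realization L)) (realization L - {b}))"
proof -
  let ?L = "realization L" and ?X = "top_of_set (realization L)"
  define U where "U = {t \<in> ?L. \<mu> t \<le> 1 / (2 * c)}"
  \<comment> \<open>As a strict sublevel set the complement of \<open>b\<close> is open, and it
    contains the closed set \<open>U\<close>, as excision demands.\<close>
  have eqA: "?L - {b} = {t \<in> ?L. \<mu> t < 1 / c}"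
  proof -
    have "t \<noteq> b \<longleftrightarrow> \<mu> t < 1 / c" if "t \<in> ?L" for t
      using min_coord_less[OF that] min_coord_barycentre by (metis less_irrefl)
    then show ?thesis
      by blast
  qed
  have cont: "continuous_map ?X euclideanreal \<mu>"
    by (simp add: continuous_on_min_coord)
  have "closedin ?X U"
    unfolding U_def using closedin_continuous_map_preimage[OF cont, of "{..1 / (2 * c)}"] by simp
  then have "?X closure_of U = U"
    by (rule closure_of_closedin)
  moreover have "openin ?X (?L - {b})"
    unfolding eqA using openin_continuous_map_preimage[OF cont, of "{..<1 / c}"] by simp
  then have "?X interior_of (?L - {b}) = ?L - {b}"
    by (rule interior_of_openin)
  moreover have "U \<subseteq> ?L - {b}"
    using min_coord_barycentre c_pos by (auto simp: U_def field_simps)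
  ultimately have "hom_induced (int n + 1) (subtopology ?X (?L - U)) (?L - {b} - U)
      (subtopology ?X ?L) (?L - {b}) id
    \<in> iso (relative_homology_group (int n + 1) (subtopology ?X (?L - U)) (?L - {b} - U))
        (relative_homology_group (int n + 1) (subtopology ?X ?L) (?L - {b}))"
    by (intro homology_excision_axiom) auto
  moreover have "?L - U = core" "?L - {b} - U = core - {b}"
    by (auto simp: U_def core_def)
  moreover have "subtopology ?X core = top_of_set core" "subtopology ?X ?L = ?X"
    by (auto simp: subtopology_subtopology core_def intro!: arg_cong[of _ _ top_of_set])
  ultimately have "relative_homology_group (int n + 1) (top_of_set core) (core - {b}) \<cong>
      relative_homology_group (int n + 1) ?X (?L - {b})"
    by (metis is_isoI)
  then show ?thesis
    using isomorphic_group_triviality1[OF _ group_relative_homology_group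
        trivial_relative_homology_core[OF assms]] by blast
qed

text \<open>In the exact sequence of the pair formed by \<open>realization L\<close> and its
  complement of \<open>b\<close>, the reduced group of the complement lies between two trivial
  groups.\<close>

lemma trivial_reduced_homology_remove_face:
  assumes "card \<tau> \<le> n + 1"
    and "trivial_group (reduced_homology_group (int n) (top_of_set (realization L)))"
  shows "trivial_group (reduced_homology_group (int n) (top_of_set (realization (L - {\<tau>}))))"
proof -
  let ?X = "top_of_set (realization L)" and ?A = "realization L - {b}"
  let ?H = "reduced_homology_group (int n) (subtopology ?X ?A)"
    and ?G = "reduced_homology_group (int n) ?X"
    and ?E = "relative_homology_group (int n + 1) ?X ?A"
  let ?i = "hom_induced (int n) (subtopology ?X ?A) {} ?X {} id"
    and ?d = "hom_boundary (int n + 1) ?X ?A"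
  have "exact_seq ([?G, ?H, ?E], [?i, ?d])"
    using homology_exactness_reduced_2[of "int n + 1" ?X ?A] by simp
  then have ker: "kernel ?H ?G ?i = ?d ` carrier ?E"
    and i: "?i \<in> hom ?H ?G" and d: "?d \<in> hom ?E ?H"
    by (simp_all add: group_hom_def group_hom_axioms_def)
  have "kernel ?H ?G ?i = carrier ?H"
    using assms(2) hom_in_carrier[OF i] by (auto simp: kernel_def trivial_group_def)
  moreover have "?d ` carrier ?E = {\<one>\<^bsub>?H\<^esub>}"
    using trivial_relative_homology_punctured[OF assms(1)] d hom_one[OF d]
    by (simp add: trivial_group_def)
  ultimately have "trivial_group ?H"
    using ker by (simp add: trivial_group_def)
  moreover have "subtopology ?X ?A = top_of_set ?A"
    by (simp add: subtopology_subtopology Int_absorb1)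
  ultimately have "trivial_group (reduced_homology_group (int n) (top_of_set ?A))"
    by simp
  then show ?thesis
    by (rule trivial_reduced_homology_homotopy_invariant
        [OF iffD1[OF homotopy_equivalent_space_sym punctured_homotopy_eqv]])
qed

end

subsection \<open>Subcomplexes of the boundary of a simplex\<close>

text \<open>Induction on the number of faces of \<open>L\<close> missing from \<open>K\<close>: one
  of largest cardinality is removed. A face of \<open>L\<close> above it is also missing, since
  \<open>K\<close> is down-closed, so the chosen face is maximal in \<open>L\<close>.\<close>

lemma trivial_reduced_homology_subcomplex:
  assumes "finite (\<Union>L)" "down_closed L" "down_closed K" "K \<subseteq> L" "K \<noteq> {}"
    and "\<And>\<tau>. \<tau> \<in> L \<Longrightarrow> card \<tau> \<le> n + 1"
    and "trivial_group (reduced_homology_group (int n) (top_of_set (realization L)))"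
  shows "trivial_group (reduced_homology_group (int n) (top_of_set (realization K)))"
  using assms(1,2,4,6,7)
proof (induction "card (L - K)" arbitrary: L)
  case 0
  have "finite L"
    using 0 by (simp add: finite_UnionD)
  then show ?case
    using 0 by auto
next
  case (Suc k)
  have fin: "finite (L - K)"
    using Suc.prems(1) by (simp add: finite_UnionD)
  have "L - K \<noteq> {}"
    using Suc.hyps(2) by (metis card.empty nat.distinct(1))
  then have "Max (card ` (L - K)) \<in> card ` (L - K)"
    using fin by (intro Max_in) auto
  then obtain \<tau> where \<tau>: "\<tau> \<in> L - K" "Max (card ` (L - K)) = card \<tau>"
    by (rule imageE)
  have le: "card \<rho> \<le> card \<tau>" if "\<rho> \<in> L - K" for \<rho>
    using that fin \<tau>(2) Max_ge[of "card ` (L - K)" "card \<rho>"] by simp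
  interpret maximal_face L \<tau>
  proof
    show "\<tau> \<in> L" "finite (\<Union>L)" "down_closed L"
      using \<tau> Suc.prems by auto
    show "\<tau> \<noteq> {}"
      using \<tau>(1) \<open>K \<noteq> {}\<close> down_closedD[OF assms(3)] by blast
    fix \<rho> assume \<rho>: "\<rho> \<in> L" "\<tau> \<subseteq> \<rho>"
    then have "\<rho> \<in> L - K"
      using \<tau>(1) down_closedD[OF assms(3)] by blast
    then have "card \<rho> \<le> card \<tau>"
      by (rule le)
    moreover have "finite \<rho>"
      using \<rho>(1) Suc.prems(1) by (meson Union_upper finite_subset)
    ultimately show "\<rho> = \<tau>"
      using \<rho>(2) card_seteq by metis
  qed
  show ?case
  proof (rule Suc.hyps(1)[of "L - {\<tau>}"])
    have "L - {\<tau>} - K = L - K - {\<tau>}"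
      by auto
    then show "k = card (L - {\<tau>} - K)"
      using Suc.hyps(2) \<tau>(1) fin by simp
    show "finite (\<Union>(L - {\<tau>}))"
      by (rule finite_subset[OF _ Suc.prems(1)]) blast
    show "down_closed (L - {\<tau>})"
      using down_closedD[OF Suc.prems(2)] maximal unfolding down_closed_def by blast
    show "K \<subseteq> L - {\<tau>}"
      using Suc.prems(3) \<tau>(1) by blast
    show "card \<rho> \<le> n + 1" if "\<rho> \<in> L - {\<tau>}" for \<rho>
      using that Suc.prems(4) by blast
    show "trivial_group (reduced_homology_group (int n) (top_of_set (realization (L - {\<tau>}))))"
      using trivial_reduced_homology_remove_face Suc.prems(4,5) face by blast
  qed
qed

text \<open>Adding the apex to the support of a point gives a face again, so the segment from the
  point to the vertex \<open>v\<close> stays in the realization.\<close>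

lemma contractible_realization_cone:
  assumes fin: "finite (\<Union>L)" and dc: "down_closed L"
    and cone: "\<And>\<tau>. \<tau> \<in> L \<Longrightarrow> insert v \<tau> \<in> L" and "L \<noteq> {}"
  shows "contractible_space (top_of_set (realization L))"
proof -
  define p :: "'a \<Rightarrow> real" where "p w = (if w = v then 1 else 0)" for w
  have supp_p: "supp p = {v}"
    by (auto simp: p_def)
  have v: "{v} \<in> L"
    using \<open>L \<noteq> {}\<close> cone down_closedD[OF dc] by blast
  have p: "p \<in> realization L"
    by (rule realizationI[of "{v}"]) (use v supp_p in \<open>auto simp: p_def\<close>)
  have "(\<lambda>w. (1 - s) * t w + s * p w) \<in> realization L"
    if "s \<in> {0..1}" "t \<in> realization L" for s t
  proof (rule segment_in_realization[OF that p dc])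
    show "supp t \<union> supp p \<in> L"
      using cone[OF realizationD(2)[OF that(2)]] supp_p by simp
    then show "finite (supp t \<union> supp p)"
      using fin by (meson Union_upper finite_subset)
  qed
  then show ?thesis
    unfolding contractible_space_def
    by (intro exI[of _ p] homotopic_straight_line) (auto intro: continuous_on_id')
qed

text \<open>A proper subcomplex misses a facet \<open>V - {v}\<close>, so it lies in the cone with apex \<open>v\<close> over
  the boundary of that facet.\<close>

lemma proper_subcomplex_not_homotopy_sphere:
  assumes "card V = n + 2" "down_closed K" "K \<subset> boundary_complex V"
  shows "\<not> top_of_set (realization K) homotopy_equivalent_space nsphere n"
proof
  assume eqv: "top_of_set (realization K) homotopy_equivalent_space nsphere n"
  have finV: "finite V"
    using assms(1) card.infinite by fastforce
  obtain \<rho> where \<rho>: "\<rho> \<subset> V" "\<rho> \<notin> K"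
    using assms(3) by (auto simp: boundary_complex_def)
  then obtain v where v: "v \<in> V" "\<rho> \<subseteq> V - {v}"
    by blast
  then have F: "V - {v} \<notin> K"
    using \<rho>(2) down_closedD[OF assms(2)] by blast
  \<comment> \<open>This is the cone: \<tau> fails to contain \<open>V - {v}\<close> exactly if
    \<open>\<tau> - {v}\<close> is a proper subset of it.\<close>
  define L where "L = {\<tau>. \<tau> \<subseteq> V \<and> \<not> V - {v} \<subseteq> \<tau>}"
  have fin: "finite (\<Union>L)"
    by (rule finite_subset[OF _ finV]) (auto simp: L_def)
  have dc: "down_closed L"
    by (auto simp: down_closed_def L_def)
  have "card (V - {v}) = n + 1"
    using assms(1) v(1) finV by simp
  then have "V - {v} \<noteq> {}"
    by (metis card.empty add_eq_0_iff_both_eq_0 one_neq_zero)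
  then have "{} \<in> L"
    by (auto simp: L_def)
  have "contractible_space (top_of_set (realization L))"
    by (rule contractible_realization_cone[OF fin dc, of v])
       (use v(1) \<open>{} \<in> L\<close> in \<open>auto simp: L_def\<close>)
  then have L: "trivial_group (reduced_homology_group (int n) (top_of_set (realization L)))"
    by (rule trivial_reduced_homology_group_contractible_space)
  have "trivial_group (reduced_homology_group (int n) (top_of_set (realization K)))"
  proof (cases "K = {}")
    case True
    then show ?thesis
      by (simp add: realization_def trivial_reduced_homology_group_empty)
  next
    case False
    have "K \<subseteq> L"
      using assms(3) F down_closedD[OF assms(2)] by (auto simp: L_def boundary_complex_def)
    moreover have "card \<tau> \<le> n + 1" if "\<tau> \<in> L" for \<tau>
    proof -
      have "\<tau> \<subset> V"
        using that by (auto simp: L_def)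
      then have "card \<tau> < card V"
        by (rule psubset_card_mono[OF finV])
      then show ?thesis
        using assms(1) by simp
    qed
    ultimately show ?thesis
      using trivial_reduced_homology_subcomplex[OF fin dc assms(2) _ False _ L] by blast
  qed
  then have "trivial_group (reduced_homology_group (int n) (nsphere n))"
    using trivial_reduced_homology_homotopy_invariant iffD1[OF homotopy_equivalent_space_sym eqv]
    by blast
  then show False
    by (simp add: trivial_reduced_homology_group_nsphere)
qed

lemma homotopy_sphere_iff_boundary:
  assumes "card V = n + 2" "down_closed K" "K \<subseteq> boundary_complex V"
  shows "top_of_set (realization K) homotopy_equivalent_space nsphere n \<longleftrightarrow> K = boundary_complex V"
  using proper_subcomplex_not_homotopy_sphere[OF assms(1,2)] assms(3)
    homeomorphic_imp_homotopy_equivalent_space[OF realization_boundary_homeomorphic_nsphere[OF assms(1)]]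
  by (auto simp: psubset_eq)

subsection \<open>The link of an element of the doubly-labeled poset\<close>

lemma in_phi_iff: "\<sigma> \<noteq> {} \<Longrightarrow> y \<in> phi Y R \<sigma> \<longleftrightarrow> y \<in> Y \<and> (\<forall>x\<in>\<sigma>. (x, y) \<in> R)"
  by (auto simp: phi_def row_def)

lemma in_psi_iff: "x \<in> psi X R \<gamma> \<longleftrightarrow> x \<in> X \<and> (\<forall>y\<in>\<gamma>. (x, y) \<in> R)"
  by (auto simp: psi_def col_def)

lemma doubly_labeledD:
  assumes "(\<sigma>, \<gamma>) \<in> doubly_labeled X Y R"
  shows "\<sigma> \<noteq> {}" "\<gamma> \<noteq> {}" "\<sigma> \<subseteq> X" "\<gamma> \<subseteq> Y" "phi Y R \<sigma> = \<gamma>"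
    and "\<And>x. x \<in> \<sigma> \<longleftrightarrow> x \<in> X \<and> (\<forall>y\<in>\<gamma>. (x, y) \<in> R)"
    and "\<And>y. y \<in> \<gamma> \<longleftrightarrow> y \<in> Y \<and> (\<forall>x\<in>\<sigma>. (x, y) \<in> R)"
proof -
  have *: "\<sigma> \<noteq> {}" "\<gamma> \<noteq> {}" "\<sigma> \<in> dowker_Psi X Y R" "\<gamma> \<in> dowker_Phi X Y R"
    and \<sigma>: "\<sigma> = psi X R \<gamma>" and \<gamma>: "\<gamma> = phi Y R \<sigma>"
    using assms unfolding doubly_labeled_def mem_Collect_eq case_prod_conv by blast+
  show "\<sigma> \<noteq> {}" "\<gamma> \<noteq> {}" "phi Y R \<sigma> = \<gamma>"
    by (fact *(1), fact *(2), fact \<gamma>[symmetric])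
  show "\<sigma> \<subseteq> X" "\<gamma> \<subseteq> Y"
    using *(3,4) by (simp_all add: dowker_Psi_def dowker_Phi_def)
  show "x \<in> \<sigma> \<longleftrightarrow> x \<in> X \<and> (\<forall>y\<in>\<gamma>. (x, y) \<in> R)" for x
    using in_psi_iff[of x X R \<gamma>] unfolding \<sigma>[symmetric] .
  show "y \<in> \<gamma> \<longleftrightarrow> y \<in> Y \<and> (\<forall>x\<in>\<sigma>. (x, y) \<in> R)" for y
    using in_phi_iff[OF *(1), of y Y R] unfolding \<gamma>[symmetric] .
qed

context
  fixes X :: "'a set" and Y :: "'b set" and R \<sigma> \<gamma>
  assumes P: "(\<sigma>, \<gamma>) \<in> doubly_labeled X Y R"
begin

lemmas label = doubly_labeledD[OF P]

lemma in_link_rows_iff: "x \<in> link_rows X Y R \<sigma> \<longleftrightarrow> x \<in> X \<and> x \<notin> \<sigma> \<and> (\<exists>y\<in>\<gamma>. (x, y) \<in> R)"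
  by (auto simp: link_rows_def col_def label(5))

text \<open>A \<open>y\<close> witnessing that \<open>\<tau> \<union> \<sigma>\<close> is a simplex
  is related to all of \<sigma> and hence lies in \<gamma>; conversely every element of \<gamma> is
  related to all of \<sigma>.\<close>

lemma simplicial_link_eq_dowker_Psi:
  "simplicial_link (dowker_Psi X Y R) \<sigma> = dowker_Psi (link_rows X Y R \<sigma>) \<gamma> (link_rel X Y R \<sigma>)"
proof (intro equalityI subsetI)
  fix \<tau> assume "\<tau> \<in> simplicial_link (dowker_Psi X Y R) \<sigma>"
  then obtain y where \<tau>: "\<tau> \<subseteq> X" "\<tau> \<inter> \<sigma> = {}" and y: "y \<in> Y" "\<forall>x\<in>\<tau> \<union> \<sigma>. (x, y) \<in> R"
    by (auto simp: simplicial_link_def dowker_Psi_def)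
  have "y \<in> \<gamma>"
    using y label(7) by auto
  then have "\<tau> \<subseteq> link_rows X Y R \<sigma>"
    using \<tau> y(2) in_link_rows_iff by blast
  then show "\<tau> \<in> dowker_Psi (link_rows X Y R \<sigma>) \<gamma> (link_rel X Y R \<sigma>)"
    using \<open>y \<in> \<gamma>\<close> y(2) unfolding dowker_Psi_def link_rel_def label(5) by blast
next
  fix \<tau> assume "\<tau> \<in> dowker_Psi (link_rows X Y R \<sigma>) \<gamma> (link_rel X Y R \<sigma>)"
  then obtain y where \<tau>: "\<tau> \<subseteq> link_rows X Y R \<sigma>" and y: "y \<in> \<gamma>" "\<forall>x\<in>\<tau>. (x, y) \<in> R"
    by (auto simp: dowker_Psi_def link_rel_def)
  have "y \<in> Y" "\<forall>x\<in>\<sigma>. (x, y) \<in> R"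
    using y(1) label(7) by auto
  then have "\<exists>y\<in>Y. \<forall>x\<in>\<tau> \<union> \<sigma>. (x, y) \<in> R"
    using y(2) by blast
  moreover have "\<tau> \<union> \<sigma> \<subseteq> X" "\<tau> \<inter> \<sigma> = {}"
    using \<tau> label(3) by (auto simp: in_link_rows_iff)
  ultimately show "\<tau> \<in> simplicial_link (dowker_Psi X Y R) \<sigma>"
    by (auto simp: simplicial_link_def dowker_Psi_def)
qed

text \<open>This absorbs the convention for empty \<open>link_rows\<close>: the empty face is always
  present, and a witness for a nonempty subset of \<gamma> outside \<sigma> is automatically a link
  row.\<close>

lemma in_link_Phi_iff:
  "\<eta> \<in> link_Phi X Y R \<sigma> \<longleftrightarrow>
    \<eta> = {} \<or> \<eta> \<subseteq> \<gamma> \<and> (\<exists>x\<in>X - \<sigma>. \<forall>y\<in>\<eta>. (x, y) \<in> R)"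
proof (cases "link_rows X Y R \<sigma> = {}")
  case True
  then have "\<eta> = {}" if "\<eta> \<subseteq> \<gamma>" "x \<in> X - \<sigma>" "\<forall>y\<in>\<eta>. (x, y) \<in> R" for x
    using that in_link_rows_iff[of x] by blast
  then show ?thesis
    using True label(2,5) by (auto simp: link_Phi_def)
next
  case False
  have "(\<exists>x\<in>link_rows X Y R \<sigma>. \<forall>y\<in>\<eta>. (x, y) \<in> link_rel X Y R \<sigma>) \<longleftrightarrow>
      \<eta> = {} \<or> (\<exists>x\<in>X - \<sigma>. \<forall>y\<in>\<eta>. (x, y) \<in> R)" if "\<eta> \<subseteq> \<gamma>"
  proof
    assume "\<exists>x\<in>link_rows X Y R \<sigma>. \<forall>y\<in>\<eta>. (x, y) \<in> link_rel X Y R \<sigma>"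
    then show "\<eta> = {} \<or> (\<exists>x\<in>X - \<sigma>. \<forall>y\<in>\<eta>. (x, y) \<in> R)"
      using in_link_rows_iff unfolding link_rel_def by blast
  next
    assume "\<eta> = {} \<or> (\<exists>x\<in>X - \<sigma>. \<forall>y\<in>\<eta>. (x, y) \<in> R)"
    then have "\<exists>x\<in>link_rows X Y R \<sigma>. \<forall>y\<in>\<eta>. (x, y) \<in> R"
    proof (cases "\<eta> = {}")
      case True
      then show ?thesis
        using False by auto
    next
      case ne: False
      then obtain x where "x \<in> X - \<sigma>" "\<forall>y\<in>\<eta>. (x, y) \<in> R"
        using \<open>\<eta> = {} \<or> _\<close> by blast
      then have "x \<in> link_rows X Y R \<sigma>"
        unfolding in_link_rows_iff using ne \<open>\<eta> \<subseteq> \<gamma>\<close> by blast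
      with \<open>\<forall>y\<in>\<eta>. (x, y) \<in> R\<close> show ?thesis ..
    qed
    then show "\<exists>x\<in>link_rows X Y R \<sigma>. \<forall>y\<in>\<eta>. (x, y) \<in> link_rel X Y R \<sigma>"
      using that unfolding link_rel_def label(5) by blast
  qed
  moreover have "link_Phi X Y R \<sigma> = dowker_Phi (link_rows X Y R \<sigma>) \<gamma> (link_rel X Y R \<sigma>)"
    using False by (simp add: link_Phi_def label(5))
  ultimately show ?thesis
    unfolding dowker_Phi_def by auto
qed

lemma down_closed_link_Phi: "down_closed (link_Phi X Y R \<sigma>)"
  unfolding down_closed_def
proof (intro ballI allI impI)
  fix \<tau> \<rho> assume "\<tau> \<in> link_Phi X Y R \<sigma>" and sub: "\<rho> \<subseteq> \<tau>"
  then consider "\<tau> = {}" | x where "\<tau> \<subseteq> \<gamma>" "x \<in> X - \<sigma>" "\<forall>y\<in>\<tau>. (x, y) \<in> R"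
    unfolding in_link_Phi_iff by blast
  then show "\<rho> \<in> link_Phi X Y R \<sigma>"
    unfolding in_link_Phi_iff using sub by cases blast+
qed

text \<open>An \<open>x\<close> related to all of \<gamma> belongs to \<sigma>, so no witness
  outside \<sigma> can yield \<gamma> itself as a face.\<close>

lemma link_Phi_subset_boundary: "link_Phi X Y R \<sigma> \<subseteq> boundary_complex \<gamma>"
proof
  fix \<eta> assume "\<eta> \<in> link_Phi X Y R \<sigma>"
  then consider "\<eta> = {}" | x where "\<eta> \<subseteq> \<gamma>" "x \<in> X - \<sigma>" "\<forall>y\<in>\<eta>. (x, y) \<in> R"
    unfolding in_link_Phi_iff by blast
  then have "\<eta> \<subset> \<gamma>"
  proof cases
    case 1
    then show ?thesis
      using label(2) by blast
  next
    case (2 x)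
    then have "\<not> (\<forall>y\<in>\<gamma>. (x, y) \<in> R)"
      using label(6)[of x] by blast
    then show ?thesis
      using 2(1,3) by blast
  qed
  then show "\<eta> \<in> boundary_complex \<gamma>"
    by (simp add: boundary_complex_def)
qed

text \<open>The empty and the void complex have the same empty realization, so Dowker duality
  carries over to \<open>link_Phi\<close> despite its convention.\<close>

lemma realization_link_Phi:
  "realization (link_Phi X Y R \<sigma>) =
    realization (dowker_Phi (link_rows X Y R \<sigma>) \<gamma> (link_rel X Y R \<sigma>))"
proof (cases "link_rows X Y R \<sigma> = {}")
  case True
  then show ?thesis
    using label(2) by (auto simp: link_Phi_def dowker_Phi_def label(5) realization_def)
qed (simp add: link_Phi_def label(5))

lemma homotopy_sphere_link_iff:
  assumes "finite X" "finite Y"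
  shows "homotopy_sphere (simplicial_link (dowker_Psi X Y R) \<sigma>) (int (card \<gamma>) - 2) \<longleftrightarrow>
    link_Phi X Y R \<sigma> = boundary_complex \<gamma>"
proof -
  let ?A = "link_rows X Y R \<sigma>" and ?Q = "link_rel X Y R \<sigma>"
  have finA: "finite ?A"
    by (rule finite_subset[OF _ assms(1)]) (auto simp: in_link_rows_iff)
  have fin\<gamma>: "finite \<gamma>"
    using assms(2) label(4) finite_subset by blast
  then have "0 < card \<gamma>"
    using label(2) by (simp add: card_gt_0_iff)
  then consider "card \<gamma> = 1" | n where "card \<gamma> = n + 2"
    by (metis One_nat_def Suc_eq_plus1 add_2_eq_Suc' gr0_implies_Suc not0_implies_Suc)
  then show ?thesis
  proof cases
    case 1
    then obtain y where \<gamma>: "\<gamma> = {y}"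
      by (auto simp: card_1_singleton_iff)
    \<comment> \<open>The sphere has dimension -1 here. Any \<open>x\<close> related to the only
      element of \<gamma> already lies in \<sigma>, so both sides of the equivalence hold.\<close>
    then have "?A = {}"
      using label(6) in_link_rows_iff by auto
    then have "simplicial_link (dowker_Psi X Y R) \<sigma> = {{}}"
      unfolding simplicial_link_eq_dowker_Psi using \<gamma> by (auto simp: dowker_Psi_def)
    moreover have "link_Phi X Y R \<sigma> = boundary_complex \<gamma>"
      using \<open>?A = {}\<close> \<gamma> by (auto simp: link_Phi_def label(5) boundary_complex_def)
    ultimately show ?thesis
      using 1 by (simp add: homotopy_sphere_def)
  next
    case (2 n)
    let ?\<Psi> = "dowker_Psi ?A \<gamma> ?Q"
    have "finite (\<Union>?\<Psi>)"
      by (rule finite_subset[OF _ finA]) (auto simp: dowker_Psi_def)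
    then have "geometric_realization ?\<Psi> homotopy_equivalent_space top_of_set (realization ?\<Psi>)"
      by (intro homeomorphic_imp_homotopy_equivalent_space geometric_realization_homeomorphic)
    also have "\<dots> homotopy_equivalent_space top_of_set (realization (link_Phi X Y R \<sigma>))"
      unfolding realization_link_Phi by (rule dowker_duality[OF finA fin\<gamma>])
    finally have eqv: "geometric_realization ?\<Psi> homotopy_equivalent_space
        top_of_set (realization (link_Phi X Y R \<sigma>))" .
    have "homotopy_sphere (simplicial_link (dowker_Psi X Y R) \<sigma>) (int (card \<gamma>) - 2) \<longleftrightarrow>
        geometric_realization ?\<Psi> homotopy_equivalent_space nsphere n"
      unfolding simplicial_link_eq_dowker_Psi homotopy_sphere_def using 2 by simp
    also have "\<dots> \<longleftrightarrow>
        top_of_set (realization (link_Phi X Y R \<sigma>)) homotopy_equivalent_space nsphere n"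
      using homotopy_eqv_trans[OF eqv]
        homotopy_eqv_trans[OF iffD1[OF homotopy_equivalent_space_sym eqv]] by (rule iffI[rotated])
    also have "\<dots> \<longleftrightarrow> link_Phi X Y R \<sigma> = boundary_complex \<gamma>"
      by (rule homotopy_sphere_iff_boundary[OF 2 down_closed_link_Phi link_Phi_subset_boundary])
    finally show ?thesis .
  qed
qed

lemma closed_subsets_iff_link_Phi:
  assumes "\<sigma> \<noteq> X"
  shows "(\<forall>\<gamma>' \<subseteq> \<gamma>. phi Y R (psi X R \<gamma>') = \<gamma>') \<longleftrightarrow> link_Phi X Y R \<sigma> = boundary_complex \<gamma>"
proof -
  \<comment> \<open>It contains the nonempty set \<sigma>.\<close>
  have psi_ne: "psi X R \<gamma>' \<noteq> {}" if "\<gamma>' \<subseteq> \<gamma>" for \<gamma>'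
    using that label(1,6) in_psi_iff[of _ X R \<gamma>'] by blast
  show ?thesis
  proof
    assume closed: "\<forall>\<gamma>' \<subseteq> \<gamma>. phi Y R (psi X R \<gamma>') = \<gamma>'"
    have "\<eta> \<in> link_Phi X Y R \<sigma>" if \<eta>: "\<eta> \<subset> \<gamma>" for \<eta>
    proof -
      have sub: "\<eta> \<subseteq> \<gamma>"
        using \<eta> by blast
      obtain y where y: "y \<in> \<gamma>" "y \<notin> \<eta>"
        using \<eta> by blast
      have "y \<in> Y"
        using y(1) label(4) by blast
      moreover have "phi Y R (psi X R \<eta>) = \<eta>"
        using closed sub by blast
      then have "y \<notin> phi Y R (psi X R \<eta>)"
        using y(2) by simp
      \<comment> \<open>Since \<open>y\<close> is not in the closure of \<eta>, some
        \<open>x\<close> is related to all of \<eta> but not to \<open>y\<close>; as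
        \<open>y\<close> is in \<gamma>, this \<open>x\<close> is outside \<sigma>.\<close>
      ultimately obtain x where x: "x \<in> X" "\<forall>y\<in>\<eta>. (x, y) \<in> R" "(x, y) \<notin> R"
        unfolding in_phi_iff[OF psi_ne[OF sub]] Ball_def in_psi_iff by blast
      then have "x \<in> X - \<sigma>"
        using y(1) label(6)[of x] by blast
      then show ?thesis
        unfolding in_link_Phi_iff using sub x(2) by blast
    qed
    then show "link_Phi X Y R \<sigma> = boundary_complex \<gamma>"
      using link_Phi_subset_boundary by (auto simp: boundary_complex_def)
  next
    assume boundary: "link_Phi X Y R \<sigma> = boundary_complex \<gamma>"
    show "\<forall>\<gamma>' \<subseteq> \<gamma>. phi Y R (psi X R \<gamma>') = \<gamma>'"
    proof (intro allI impI equalityI subsetI)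
      fix \<gamma>' y assume sub: "\<gamma>' \<subseteq> \<gamma>"
      show "y \<in> phi Y R (psi X R \<gamma>')" if "y \<in> \<gamma>'"
        using that sub label(4) by (auto simp: in_phi_iff[OF psi_ne[OF sub]] in_psi_iff)
      assume "y \<in> phi Y R (psi X R \<gamma>')"
      then have y: "y \<in> Y" "\<And>x. x \<in> X \<Longrightarrow> \<forall>y\<in>\<gamma>'. (x, y) \<in> R \<Longrightarrow> (x, y) \<in> R"
        unfolding in_phi_iff[OF psi_ne[OF sub]] Ball_def in_psi_iff by blast+
      have "(x, y) \<in> R" if "x \<in> \<sigma>" for x
        using y(2)[of x] that sub label(6)[of x] by blast
      then have "y \<in> \<gamma>"
        using y(1) label(7)[of y] by blast
      show "y \<in> \<gamma>'"
      proof (rule ccontr)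
        assume "y \<notin> \<gamma>'"
        \<comment> \<open>A witness outside \<sigma> for this face is related to all of \<gamma>',
          hence also to \<open>y\<close> by closure, and so to all of \<gamma>, which would put it
          in \<sigma>.\<close>
        have "\<gamma> - {y} \<in> link_Phi X Y R \<sigma>"
          unfolding boundary boundary_complex_def using \<open>y \<in> \<gamma>\<close> by blast
        \<comment> \<open>If \<gamma> is just \<open>{y}\<close>, the face is empty and a witness
          exists only because \<sigma> is not all of \<open>X\<close>.\<close>
        moreover have "X - \<sigma> \<noteq> {}"
          using assms label(3) by blast
        ultimately obtain x where x: "x \<in> X" "x \<notin> \<sigma>" "\<forall>z\<in>\<gamma> - {y}. (x, z) \<in> R"
          unfolding in_link_Phi_iff by blast
        then have "(x, y) \<in> R"
          using y(2)[of x] sub \<open>y \<notin> \<gamma>'\<close> by blast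
        then show False
          using x label(6)[of x] by blast
      qed
    qed
  qed
qed

end

theorem theorem11:
  fixes X :: "'a set" and Y :: "'b set" and R :: "('a \<times> 'b) set"
    and \<sigma> :: "'a set" and \<gamma> :: "'b set"
  assumes "finite X" and "finite Y" and "R \<subseteq> X \<times> Y"
    and "(\<sigma>, \<gamma>) \<in> doubly_labeled X Y R"
    and "\<sigma> \<noteq> X"
  shows "((\<forall>\<gamma>' \<subseteq> \<gamma>. phi Y R (psi X R \<gamma>') = \<gamma>') \<longleftrightarrow>
            homotopy_sphere (simplicial_link (dowker_Psi X Y R) \<sigma>) (int (card \<gamma>) - 2))
       \<and> (homotopy_sphere (simplicial_link (dowker_Psi X Y R) \<sigma>) (int (card \<gamma>) - 2) \<longleftrightarrow>
            link_Phi X Y R \<sigma> = boundary_complex \<gamma>)"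
  using closed_subsets_iff_link_Phi[OF assms(4,5)] homotopy_sphere_link_iff[OF assms(4,1,2)]
  by simp

end
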